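(* Let $\mathcal{G}$ be a finite connected planar graph embedded in the plane, containing at least one cycle, with conductances $c:E\to\mathbb{R}_{>0}$. Consider a random spanning unicycle of $\mathcal{G}$ chosen with probability proportional to its weight, and let $A$ be the area of its unique cycle, i.e. the number of faces of $\mathcal{G}$ enclosed by it. Let $f,f'$ be two faces of $\mathcal{G}$. Then $$\mathbb{P}(f\text{ enclosed})=\frac{\kappa(\mathcal{G})}{\lambda(\mathcal{G})}\,G^*_{f,f},\qquad \mathbb{P}(f,f'\text{ enclosed})=\frac{\kappa(\mathcal{G})}{\lambda(\mathcal{G})}\,G^*_{f,f'}.$$ Moreover $$\mathbb{E}(A)=\frac{\kappa(\mathcal{G})}{\lambda(\mathcal{G})}\sum_{v^*\in V^*}G^*_{v^*,v^*}\qquad\text{and}\qquad \mathbb{E}(A^2)=\frac{\kappa(\mathcal{G})}{\lambda(\mathcal{G})}\,|V^*|\,\mathbb{E}(\tau_{b^*}),$$ where $\mathbb{E}(\tau_{b^*})$ is the expected hitting time of $b^*$ for the conductance-biased random walk on $\mathcal{G}^*$ started at a uniformly chosen vertex of $\mathcal{G}^*$.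
   Context: A spanning unicycle (cycle-rooted spanning tree, CRST) of $\mathcal{G}$ is a connected spanning subgraph with a unique cycle, i.e. the union of a spanning tree and one additional edge. The weight of a subgraph is the product of the conductances of its edges. $\kappa(\mathcal{G})$ is the sum of the weights of all spanning trees of $\mathcal{G}$ and $\lambda(\mathcal{G})$ is the sum of the weights of all CRSTs of $\mathcal{G}$. $\mathcal{G}^*$ is the planar dual graph (possibly with parallel edges and loops), with vertex set $V^*$ equal to the set of all faces of $\mathcal{G}$, including the outer face, and with the edge $e^*$ dual to $e$ given conductance $c(e^* )=1/c(e)$. The marked vertex $b^*\in V^*$ is the outer face of $\mathcal{G}$. The Laplacian of $\mathcal{G}^*$ is $\Delta^* h(v)=\sum_{v'\sim v}c_{vv'}(h(v)-h(v'))$ (sum over edges with multiplicity), and $G^*$ is the inverse of the matrix obtained from $\Delta^*$ by deleting the row and column of $b^*$, extended by $G^*_{u,v}=0$ if $u=b^*$ or $v=b^*$. The conductance-biased random walk on $\mathcal{G}^*$ is taken in continuous time with generator $-\Delta^*$ (jumping from $v$ to $v'$ at rate $c_{vv'}$), so that $\mathbb{E}(\tau_{b^*})=\frac1{|V^*|}\sum_{u,v\in V^*}G^*_{u,v}$. *)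

theory Defs
  imports "HOL-Probability.Probability"
begin

section \<open>Finite weighted multigraphs\<close>

text \<open>
  An undirected multigraph is given by a vertex set \<open>V\<close>, a set \<open>E\<close> of edge names and a map \<open>ends\<close>
  sending an edge to the set of its one (for a loop) or two end vertices. A spanning subgraph is
  identified with its edge set.
\<close>

definition spanning_connected :: "'v set \<Rightarrow> ('e \<Rightarrow> 'v set) \<Rightarrow> 'e set \<Rightarrow> bool" where
  "spanning_connected V ends F \<longleftrightarrow>
     (\<forall>u\<in>V. \<forall>v\<in>V. (u, v) \<in> {(x, y). \<exists>e\<in>F. ends e = {x, y}}\<^sup>*)"

text \<open>
  A cycle is the edge set of a closed walk of length \<open>n \<ge> 1\<close> without repeated vertices or edges: a
  loop for \<open>n = 1\<close>, a pair of parallel edges for \<open>n = 2\<close>.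
\<close>

definition is_cycle :: "('e \<Rightarrow> 'v set) \<Rightarrow> 'e set \<Rightarrow> bool" where
  "is_cycle ends C \<longleftrightarrow>
     (\<exists>vs es. vs \<noteq> [] \<and> length es = length vs \<and> distinct vs \<and> distinct es \<and> set es = C \<and>
        (\<forall>i<length es. ends (es ! i) = {vs ! i, vs ! (Suc i mod length vs)}))"

definition spanning_trees :: "'v set \<Rightarrow> 'e set \<Rightarrow> ('e \<Rightarrow> 'v set) \<Rightarrow> 'e set set" where
  "spanning_trees V E ends =
     {F. F \<subseteq> E \<and> spanning_connected V ends F \<and> \<not> (\<exists>C\<subseteq>F. is_cycle ends C)}"

definition spanning_unicycles :: "'v set \<Rightarrow> 'e set \<Rightarrow> ('e \<Rightarrow> 'v set) \<Rightarrow> 'e set set" where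
  "spanning_unicycles V E ends =
     {F. F \<subseteq> E \<and> spanning_connected V ends F \<and> (\<exists>!C. C \<subseteq> F \<and> is_cycle ends C)}"

definition cycle_of :: "('e \<Rightarrow> 'v set) \<Rightarrow> 'e set \<Rightarrow> 'e set" where
  "cycle_of ends F = (THE C. C \<subseteq> F \<and> is_cycle ends C)"

definition weight :: "('e \<Rightarrow> real) \<Rightarrow> 'e set \<Rightarrow> real" where
  "weight c F = (\<Prod>e\<in>F. c e)"

definition kappa :: "'v set \<Rightarrow> 'e set \<Rightarrow> ('e \<Rightarrow> 'v set) \<Rightarrow> ('e \<Rightarrow> real) \<Rightarrow> real" where
  "kappa V E ends c = (\<Sum>F\<in>spanning_trees V E ends. weight c F)"

definition lambda :: "'v set \<Rightarrow> 'e set \<Rightarrow> ('e \<Rightarrow> 'v set) \<Rightarrow> ('e \<Rightarrow> real) \<Rightarrow> real" where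
  "lambda V E ends c = (\<Sum>F\<in>spanning_unicycles V E ends. weight c F)"

definition random_unicycle ::
    "'v set \<Rightarrow> 'e set \<Rightarrow> ('e \<Rightarrow> 'v set) \<Rightarrow> ('e \<Rightarrow> real) \<Rightarrow> 'e set pmf" where
  "random_unicycle V E ends c =
     embed_pmf (\<lambda>F. if F \<in> spanning_unicycles V E ends
                    then weight c F / lambda V E ends c else 0)"

definition laplacian ::
    "'v set \<Rightarrow> 'e set \<Rightarrow> ('e \<Rightarrow> 'v set) \<Rightarrow> ('e \<Rightarrow> real) \<Rightarrow> ('v \<Rightarrow> real) \<Rightarrow> 'v \<Rightarrow> real" where
  "laplacian V E ends c h v =
     (\<Sum>v'\<in>V. \<Sum>e | e \<in> E \<and> ends e = {v, v'}. c e * (h v - h v'))"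

definition laplacian_matrix ::
    "'v set \<Rightarrow> 'e set \<Rightarrow> ('e \<Rightarrow> 'v set) \<Rightarrow> ('e \<Rightarrow> real) \<Rightarrow> 'v \<Rightarrow> 'v \<Rightarrow> real" where
  "laplacian_matrix V E ends c u v = laplacian V E ends c (\<lambda>w. if w = v then 1 else 0) u"

text \<open>
  The two-sided inverse of the square matrix \<open>M\<close> with rows and columns indexed by the finite set
  \<open>S\<close>, extended by zero outside \<open>S \<times> S\<close>.
\<close>

definition matrix_inverse_on :: "'v set \<Rightarrow> ('v \<Rightarrow> 'v \<Rightarrow> real) \<Rightarrow> 'v \<Rightarrow> 'v \<Rightarrow> real" where
  "matrix_inverse_on S M =
     (THE N. (\<forall>u v. u \<notin> S \<or> v \<notin> S \<longrightarrow> N u v = 0) \<and>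
             (\<forall>u\<in>S. \<forall>v\<in>S. (\<Sum>w\<in>S. M u w * N w v) = (if u = v then 1 else 0) \<and>
                           (\<Sum>w\<in>S. N u w * M w v) = (if u = v then 1 else 0)))"

definition green ::
    "'v set \<Rightarrow> 'e set \<Rightarrow> ('e \<Rightarrow> 'v set) \<Rightarrow> ('e \<Rightarrow> real) \<Rightarrow> 'v \<Rightarrow> 'v \<Rightarrow> 'v \<Rightarrow> real" where
  "green V E ends c b = matrix_inverse_on (V - {b}) (laplacian_matrix V E ends c)"


section \<open>Plane graphs and their duals\<close>

text \<open>
  The plane is \<^typ>\<open>complex\<close>. An edge \<open>e\<close> is drawn as the curve \<open>\<gamma> e\<close>; since \<^const>\<open>simple_path\<close>
  allows the two end points of a path to coincide, loops are included, and so are parallel edges.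
\<close>

definition plane_graph :: "complex set \<Rightarrow> 'e set \<Rightarrow> ('e \<Rightarrow> real \<Rightarrow> complex) \<Rightarrow> bool" where
  "plane_graph V E \<gamma> \<longleftrightarrow>
     finite V \<and> V \<noteq> {} \<and> finite E \<and>
     (\<forall>e\<in>E. simple_path (\<gamma> e) \<and> pathstart (\<gamma> e) \<in> V \<and> pathfinish (\<gamma> e) \<in> V \<and>
            \<gamma> e ` {0<..<1} \<inter> V = {}) \<and>
     (\<forall>e\<in>E. \<forall>e'\<in>E. e \<noteq> e' \<longrightarrow> \<gamma> e ` {0<..<1} \<inter> path_image (\<gamma> e') = {})"

definition curve_ends :: "('e \<Rightarrow> real \<Rightarrow> complex) \<Rightarrow> 'e \<Rightarrow> complex set" where
  "curve_ends \<gamma> e = {pathstart (\<gamma> e), pathfinish (\<gamma> e)}"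

definition faces :: "complex set \<Rightarrow> 'e set \<Rightarrow> ('e \<Rightarrow> real \<Rightarrow> complex) \<Rightarrow> complex set set" where
  "faces V E \<gamma> = components (- (V \<union> (\<Union>e\<in>E. path_image (\<gamma> e))))"

definition outer_face :: "complex set \<Rightarrow> 'e set \<Rightarrow> ('e \<Rightarrow> real \<Rightarrow> complex) \<Rightarrow> complex set" where
  "outer_face V E \<gamma> = (THE f. f \<in> faces V E \<gamma> \<and> \<not> bounded f)"

text \<open>
  The dual edge of \<open>e\<close> joins the faces having \<open>e\<close> on their frontier. There are two of them, or just
  one when \<open>e\<close> is a bridge, in which case the dual edge is a loop. The dual multigraph has vertex set
  \<^const>\<open>faces\<close>, the edge names of the primal graph, and the following incidence and conductances.
\<close>

definition dual_ends ::
    "complex set \<Rightarrow> 'e set \<Rightarrow> ('e \<Rightarrow> real \<Rightarrow> complex) \<Rightarrow> 'e \<Rightarrow> complex set set" where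
  "dual_ends V E \<gamma> e = {f \<in> faces V E \<gamma>. path_image (\<gamma> e) \<subseteq> frontier f}"

definition dual_conductance :: "('e \<Rightarrow> real) \<Rightarrow> 'e \<Rightarrow> real" where
  "dual_conductance c e = 1 / c e"

definition dual_laplacian_matrix ::
    "complex set \<Rightarrow> 'e set \<Rightarrow> ('e \<Rightarrow> real \<Rightarrow> complex) \<Rightarrow> ('e \<Rightarrow> real) \<Rightarrow>
     complex set \<Rightarrow> complex set \<Rightarrow> real" where
  "dual_laplacian_matrix V E \<gamma> c =
     laplacian_matrix (faces V E \<gamma>) E (dual_ends V E \<gamma>) (dual_conductance c)"

definition dual_green ::
    "complex set \<Rightarrow> 'e set \<Rightarrow> ('e \<Rightarrow> real \<Rightarrow> complex) \<Rightarrow> ('e \<Rightarrow> real) \<Rightarrow>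
     complex set \<Rightarrow> complex set \<Rightarrow> real" where
  "dual_green V E \<gamma> c =
     green (faces V E \<gamma>) E (dual_ends V E \<gamma>) (dual_conductance c) (outer_face V E \<gamma>)"

definition encloses :: "('e \<Rightarrow> real \<Rightarrow> complex) \<Rightarrow> 'e set \<Rightarrow> complex set \<Rightarrow> bool" where
  "encloses \<gamma> F f \<longleftrightarrow> f \<subseteq> inside (\<Union>e\<in>cycle_of (curve_ends \<gamma>) F. path_image (\<gamma> e))"

definition cycle_area ::
    "complex set \<Rightarrow> 'e set \<Rightarrow> ('e \<Rightarrow> real \<Rightarrow> complex) \<Rightarrow> 'e set \<Rightarrow> nat" where
  "cycle_area V E \<gamma> F = card {f \<in> faces V E \<gamma>. encloses \<gamma> F f}"


section \<open>Continuous-time random walk\<close>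

text \<open>
  \<open>uniform_markov_chain M S Q X\<close>: the process \<open>X\<close> on the probability space \<open>M\<close> is a continuous-time
  Markov chain on the finite state space \<open>S\<close> with generator \<open>Q\<close> and uniform initial distribution, in
  terms of its jump chain \<open>Y\<close> and holding times \<open>T\<close>: \<open>Y\<close> is a Markov chain with transition
  probabilities \<open>Q x y / (- Q x x)\<close> for \<open>x \<noteq> y\<close>, and given \<open>Y\<close> the \<open>T n\<close> are independent and
  exponential with parameter \<open>- Q (Y n) (Y n)\<close>. States with \<open>Q x x = 0\<close> (absorbing) are not catered
  for; they do not occur for the Laplacian of a connected graph with at least two vertices.
\<close>

definition jump_prob :: "('s \<Rightarrow> 's \<Rightarrow> real) \<Rightarrow> 's \<Rightarrow> 's \<Rightarrow> real" where
  "jump_prob Q x y = (if x = y then 0 else Q x y / (- Q x x))"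

definition jump_time :: "(nat \<Rightarrow> 'w \<Rightarrow> real) \<Rightarrow> nat \<Rightarrow> 'w \<Rightarrow> real" where
  "jump_time T n \<omega> = (\<Sum>i<n. T i \<omega>)"

definition uniform_markov_chain ::
    "'w measure \<Rightarrow> 's set \<Rightarrow> ('s \<Rightarrow> 's \<Rightarrow> real) \<Rightarrow> (real \<Rightarrow> 'w \<Rightarrow> 's) \<Rightarrow> bool" where
  "uniform_markov_chain M S Q X \<longleftrightarrow>
     prob_space M \<and>
     (\<exists>(Y :: nat \<Rightarrow> 'w \<Rightarrow> 's) (T :: nat \<Rightarrow> 'w \<Rightarrow> real).
        (\<forall>n. Y n \<in> measurable M (count_space S) \<and> T n \<in> borel_measurable M) \<and>
        (\<forall>n y t. (\<forall>i\<le>n. y i \<in> S \<and> 0 \<le> t i) \<longrightarrow>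
           measure M {\<omega> \<in> space M. \<forall>i\<le>n. Y i \<omega> = y i \<and> t i < T i \<omega>} =
             1 / real (card S) * (\<Prod>i<n. jump_prob Q (y i) (y (Suc i))) *
             (\<Prod>i\<le>n. exp (Q (y i) (y i) * t i))) \<and>
        (AE \<omega> in M. \<forall>n t. 0 \<le> t \<and> jump_time T n \<omega> \<le> t \<and> t < jump_time T (Suc n) \<omega> \<longrightarrow>
           X t \<omega> = Y n \<omega>))"

definition hitting_time :: "(real \<Rightarrow> 'w \<Rightarrow> 's) \<Rightarrow> 's \<Rightarrow> 'w \<Rightarrow> ennreal" where
  "hitting_time X b \<omega> = Inf (ennreal ` {t. 0 \<le> t \<and> X t \<omega> = b})"

definition expected_hitting_time ::
    "'w measure \<Rightarrow> (real \<Rightarrow> 'w \<Rightarrow> 's) \<Rightarrow> 's \<Rightarrow> ennreal" where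
  "expected_hitting_time M X b = (\<integral>\<^sup>+\<omega>. hitting_time X b \<omega> \<partial>M)"

end

theory Submission
  imports Defs
begin

text \<open>
  Let \<open>M u v\<close> be the total weight of the unicycles whose cycle encloses both faces \<open>u\<close> and \<open>v\<close>. The
  probability that both are enclosed is \<open>M u v / \<lambda>\<close>, so the first two claims say that Green's
  function of the dual graph is \<open>M / \<kappa>\<close>. As \<open>M\<close> is symmetric and vanishes at the outer face, it
  suffices to show that the dual Laplacian sends \<open>M \<sqdot> v\<close> to \<open>\<kappa>\<close> times the indicator of \<open>v\<close>.

  Let \<open>e\<close> be an edge with the faces \<open>u\<close> and \<open>x\<close> on its sides. A unicycle contributes to
  \<open>M u v - M x v\<close> only if its cycle separates \<open>u\<close> from \<open>x\<close>, and then \<open>e\<close> lies on the cycle. Such a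
  unicycle is a spanning tree \<open>T\<close> together with \<open>e\<close>, its weight is \<open>c e\<close> times the weight of \<open>T\<close>, and
  the factor \<open>c e\<close> cancels against the dual conductance. Hence the Laplacian becomes a sum over trees
  \<open>T\<close>, and the contribution of each \<open>T\<close> is the signed number of fundamental cycles of \<open>T\<close> that belong
  to edges on the boundary of \<open>u\<close> and enclose \<open>v\<close> (lemma \<open>dual_laplacian_enclosing_weight\<close>). In the
  cycle space the boundary of \<open>u\<close> is the sum of these cycles, so the number is \<open>1\<close> if \<open>u = v\<close> and \<open>0\<close>
  otherwise (lemma \<open>fundamental_cycles_dual_to_faces\<close>). That lemma is proved without orienting
  anything: as a function of \<open>v\<close>, the number minus the indicator of \<open>u\<close> takes equal values on the two
  sides of every edge outside \<open>T\<close>. Since the complement of the drawing of \<open>T\<close> is connected, it is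
  constant, and it is \<open>0\<close> at the outer face.

  The topological input is thus that the complement of a tree is connected
  (\<open>tree_complement_connected\<close>), and that an edge of a cycle is adjacent to exactly two faces, one
  inside and one outside the cycle (\<open>cycle_edge_faces\<close>). Both follow from Janiszewski's theorem and
  the Jordan curve theorem.

  The area is the sum over all faces of the indicators of being enclosed. This gives its first two
  moments as the trace of \<open>M\<close> and the sum of all entries of \<open>M\<close>, divided by \<open>\<lambda>\<close>. Finally, the row
  sums \<open>g\<close> of Green's function satisfy \<open>\<Delta>* g = 1\<close> away from the outer face, which is the first-step
  equation of the expected hitting time (theorem \<open>expected_hitting_time_eq\<close>).
\<close>

section \<open>Walks, cycles and spanning trees\<close>

definition adjacency :: "('e \<Rightarrow> 'v set) \<Rightarrow> 'e set \<Rightarrow> ('v \<times> 'v) set" where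
  "adjacency ends F = {(x, y). \<exists>e\<in>F. ends e = {x, y}}"

lemma spanning_connected_iff_reachable:
  "spanning_connected V ends F \<longleftrightarrow> (\<forall>u\<in>V. \<forall>v\<in>V. (u, v) \<in> (adjacency ends F)\<^sup>*)"
  by (simp add: spanning_connected_def adjacency_def)

definition simple_walk :: "('e \<Rightarrow> 'v set) \<Rightarrow> 'v list \<Rightarrow> 'e list \<Rightarrow> bool" where
  "simple_walk ends vs es \<longleftrightarrow>
     length vs = Suc (length es) \<and> distinct vs \<and>
     (\<forall>i<length es. ends (es ! i) = {vs ! i, vs ! Suc i})"

lemma simple_walk_Nil: "simple_walk ends vs [] \<longleftrightarrow> (\<exists>v. vs = [v])"
  by (auto simp: simple_walk_def length_Suc_conv)

lemma simple_walk_Cons: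
  "simple_walk ends vs (e # es) \<longleftrightarrow>
     (\<exists>v ws. vs = v # ws \<and> v \<notin> set ws \<and> ends e = {v, hd ws} \<and> simple_walk ends ws es)"
proof
  assume L: "simple_walk ends vs (e # es)"
  then obtain v w ws where vs: "vs = v # w # ws"
    by (auto simp: simple_walk_def length_Suc_conv)
  have *: "ends ((e # es) ! i) = {vs ! i, vs ! Suc i}" if "i < Suc (length es)" for i
    using L that by (auto simp: simple_walk_def)
  have "ends e = {v, w}" using *[of 0] vs by simp
  moreover have "ends (es ! i) = {(w # ws) ! i, (w # ws) ! Suc i}" if "i < length es" for i
    using *[of "Suc i"] vs that by simp
  ultimately show "\<exists>v ws. vs = v # ws \<and> v \<notin> set ws \<and> ends e = {v, hd ws} \<and> simple_walk ends ws es"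
    using L vs unfolding simple_walk_def by auto
next
  assume "\<exists>v ws. vs = v # ws \<and> v \<notin> set ws \<and> ends e = {v, hd ws} \<and> simple_walk ends ws es"
  then obtain v ws where "vs = v # ws" "v \<notin> set ws" "ends e = {v, hd ws}" "simple_walk ends ws es"
    by blast
  then show "simple_walk ends vs (e # es)"
    by (auto simp: simple_walk_def nth_Cons hd_conv_nth length_greater_0_conv[symmetric] simp del: length_greater_0_conv split: nat.split)
qed

lemma simple_walk_ne: "simple_walk ends vs es \<Longrightarrow> vs \<noteq> []"
  by (auto simp: simple_walk_def)

lemma simple_walk_distinct_edges: "simple_walk ends vs es \<Longrightarrow> distinct es"
  unfolding distinct_conv_nth
proof (intro allI impI notI)
  fix i j assume W: "simple_walk ends vs es"
    and ij: "i < length es" "j < length es" "i \<noteq> j" "es ! i = es ! j"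
  have eq: "{vs ! i, vs ! Suc i} = {vs ! j, vs ! Suc j}"
    using W ij unfolding simple_walk_def by metis
  have "vs ! a \<noteq> vs ! b" if "a \<noteq> b" "a \<le> length es" "b \<le> length es" for a b
    using W that by (simp add: simple_walk_def nth_eq_iff_index_eq)
  from this[of i j] this[of i "Suc j"] this[of "Suc i" j] show False
    using eq ij unfolding doubleton_eq_iff by (cases "i = Suc j"; cases "Suc i = j") auto
qed

lemma simple_walk_drop:
  "simple_walk ends vs es \<Longrightarrow> k < length vs \<Longrightarrow> simple_walk ends (drop k vs) (drop k es)"
  by (auto simp: simple_walk_def)

lemma reachable_imp_simple_walk:
  assumes "(x, y) \<in> (adjacency ends F)\<^sup>*"
  shows "\<exists>vs es. simple_walk ends vs es \<and> hd vs = x \<and> last vs = y \<and> set es \<subseteq> F"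
  using assms
proof (induction rule: converse_rtrancl_induct)
  case base
  have "simple_walk ends [y] []" by (simp add: simple_walk_Nil)
  then show ?case by fastforce
next
  case (step x x')
  then obtain vs es where W: "simple_walk ends vs es" "hd vs = x'" "last vs = y" "set es \<subseteq> F"
    by blast
  obtain e where e: "e \<in> F" "ends e = {x, x'}" using step by (auto simp: adjacency_def)
  show ?case
  proof (cases "x \<in> set vs")
    case True
    then obtain k where k: "k < length vs" "vs ! k = x" by (auto simp: in_set_conv_nth)
    have "simple_walk ends (drop k vs) (drop k es)" using W k simple_walk_drop by blast
    moreover have "hd (drop k vs) = x" using k by (simp add: hd_drop_conv_nth)
    moreover have "last (drop k vs) = y" using k W by simp
    moreover have "set (drop k es) \<subseteq> F" using W set_drop_subset by fastforce
    ultimately show ?thesis by blast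
  next
    case False
    then have "simple_walk ends (x # vs) (e # es)"
      using W e by (auto simp: simple_walk_Cons)
    then show ?thesis using W e simple_walk_ne[OF W(1)] by (intro exI[of _ "x # vs"] exI[of _ "e # es"]) auto
  qed
qed

lemma simple_walk_imp_reachable:
  "simple_walk ends vs es \<Longrightarrow> set es \<subseteq> F \<Longrightarrow> (hd vs, last vs) \<in> (adjacency ends F)\<^sup>*"
proof (induction es arbitrary: vs)
  case Nil
  then show ?case by (auto simp: simple_walk_Nil)
next
  case (Cons e es)
  then obtain v ws where vs: "vs = v # ws" "ends e = {v, hd ws}" "simple_walk ends ws es"
    by (auto simp: simple_walk_Cons)
  then have "(v, hd ws) \<in> adjacency ends F" using Cons.prems by (auto simp: adjacency_def)
  moreover have "(hd ws, last ws) \<in> (adjacency ends F)\<^sup>*" using Cons vs by auto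
  ultimately show ?case using vs simple_walk_ne[OF vs(3)] by (auto intro: converse_rtrancl_into_rtrancl)
qed

lemma sym_adjacency_rtrancl: "sym ((adjacency ends F)\<^sup>*)"
  by (rule sym_rtrancl) (auto simp: adjacency_def sym_def insert_commute)

lemma adjacency_rtrancl_mono: "F \<subseteq> F' \<Longrightarrow> (adjacency ends F)\<^sup>* \<subseteq> (adjacency ends F')\<^sup>*"
  by (rule rtrancl_mono) (auto simp: adjacency_def)

text \<open>
  Cutting a cycle open at one of its edges leaves a simple walk between the end points of that edge.
  In this form cycles can be built from and reduced to walks without computing with positions in a
  cyclic list.
\<close>

lemma is_cycle_iff_walk:
  "is_cycle ends C \<and> e \<in> C \<longleftrightarrow>
     (\<exists>vs es. simple_walk ends vs es \<and> e \<notin> set es \<and> ends e = {hd vs, last vs} \<and> C = insert e (set es))"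
proof
  assume "is_cycle ends C \<and> e \<in> C"
  then obtain vs es where vs: "vs \<noteq> []" and len: "length es = length vs" and d: "distinct vs" "distinct es"
    and C: "set es = C" and ends: "\<And>i. i < length es \<Longrightarrow> ends (es ! i) = {vs ! i, vs ! (Suc i mod length vs)}"
    and eC: "e \<in> C"
    unfolding is_cycle_def by auto
  obtain k where k: "k < length es" "es ! k = e" using C eC by (metis in_set_conv_nth)
  define n where "n = length vs"
  have n: "0 < n" "length es = n" "k < n" using vs len k by (auto simp: n_def)
  \<comment> \<open>the rotation that puts the chosen edge last\<close>
  define vs' es' where "vs' = rotate (Suc k) vs" and "es' = butlast (rotate (Suc k) es)"
  have len': "length vs' = n" "length es' = n - 1" using n by (auto simp: vs'_def es'_def n_def)
  have vs'_nth: "vs' ! i = vs ! ((Suc k + i) mod n)" if "i < n" for i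
    unfolding vs'_def using nth_rotate[of i vs "Suc k"] that by (simp add: n_def)
  have es'_nth: "es' ! i = es ! ((Suc k + i) mod n)" if "i < n - 1" for i
    unfolding es'_def using nth_rotate[of i es "Suc k"] that n by (simp add: nth_butlast)
  have last_es: "last (rotate (Suc k) es) = e"
  proof -
    have "last (rotate (Suc k) es) = rotate (Suc k) es ! (n - 1)"
      using n by (subst last_conv_nth) auto
    also have "\<dots> = es ! ((Suc k + (n - 1)) mod n)" using nth_rotate[of "n - 1" es "Suc k"] n by simp
    also have "(Suc k + (n - 1)) mod n = k" using n by simp
    finally show ?thesis using k by simp
  qed
  have app: "rotate (Suc k) es = es' @ [e]"
    unfolding es'_def using last_es n by (metis append_butlast_last_id length_0_conv length_rotate less_not_refl)
  have "distinct (es' @ [e])" using app d by (metis distinct_rotate)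
  moreover have "set (es' @ [e]) = C" using app C by (metis set_rotate)
  moreover have "simple_walk ends vs' es'"
    unfolding simple_walk_def
  proof (intro conjI allI impI)
    show "length vs' = Suc (length es')" using len' n by simp
    show "distinct vs'" using d by (simp add: vs'_def)
    fix i assume i: "i < length es'"
    have "ends (es' ! i) = {vs ! ((Suc k + i) mod n), vs ! (Suc ((Suc k + i) mod n) mod n)}"
      using es'_nth[of i] ends[of "(Suc k + i) mod n"] i len' n by (simp add: n_def)
    also have "Suc ((Suc k + i) mod n) mod n = (Suc k + Suc i) mod n" by (simp add: mod_Suc_eq)
    finally show "ends (es' ! i) = {vs' ! i, vs' ! Suc i}" using vs'_nth[of i] vs'_nth[of "Suc i"] i len' by simp
  qed
  moreover have "ends e = {hd vs', last vs'}"
  proof -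
    have "vs' \<noteq> []" using len' n by auto
    then have "hd vs' = vs ! (Suc k mod n)" using vs'_nth[of 0] n by (simp add: hd_conv_nth)
    moreover have "last vs' = vs ! k" using vs'_nth[of "n - 1"] n \<open>vs' \<noteq> []\<close> len' by (simp add: last_conv_nth)
    ultimately show ?thesis using ends[of k] k by (auto simp: n_def)
  qed
  ultimately show "\<exists>vs es. simple_walk ends vs es \<and> e \<notin> set es \<and> ends e = {hd vs, last vs} \<and> C = insert e (set es)"
    by (intro exI[of _ vs'] exI[of _ es']) auto
next
  assume "\<exists>vs es. simple_walk ends vs es \<and> e \<notin> set es \<and> ends e = {hd vs, last vs} \<and> C = insert e (set es)"
  then obtain vs es where W: "simple_walk ends vs es" "e \<notin> set es" "ends e = {hd vs, last vs}" "C = insert e (set es)"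
    by blast
  let ?es = "es @ [e]"
  have len: "length vs = Suc (length es)" using W by (simp add: simple_walk_def)
  have "ends (?es ! i) = {vs ! i, vs ! (Suc i mod length vs)}" if "i < length ?es" for i
  proof (cases "i < length es")
    case True
    then show ?thesis using W(1) len by (simp add: nth_append simple_walk_def)
  next
    case False
    then have "i = length es" using that by simp
    then show ?thesis using W(3) len simple_walk_ne[OF W(1)]
      by (simp add: nth_append hd_conv_nth last_conv_nth insert_commute)
  qed
  moreover have "distinct vs" "distinct ?es"
    using W simple_walk_distinct_edges by (auto simp: simple_walk_def)
  ultimately show "is_cycle ends C \<and> e \<in> C"
    unfolding is_cycle_def using W len simple_walk_ne[OF W(1)]
    by (intro conjI exI[of _ vs] exI[of _ ?es]) auto
qed

lemma cycle_through_edge: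
  assumes "(x, y) \<in> (adjacency ends F)\<^sup>*" "ends e = {x, y}" "e \<notin> F"
  shows "\<exists>C\<subseteq>insert e F. is_cycle ends C \<and> e \<in> C"
proof -
  obtain vs es where W: "simple_walk ends vs es" "hd vs = x" "last vs = y" "set es \<subseteq> F"
    using reachable_imp_simple_walk[OF assms(1)] by blast
  have "e \<notin> set es" using W(4) assms(3) by blast
  then have "is_cycle ends (insert e (set es)) \<and> e \<in> insert e (set es)"
    unfolding is_cycle_iff_walk using W(1-3) assms(2) by (intro exI[of _ vs] exI[of _ es]) simp
  then show ?thesis using W(4) by (intro exI[of _ "insert e (set es)"]) blast
qed

lemma cycle_edge_ends_reachable:
  assumes "is_cycle ends C" "e \<in> C" "ends e = {x, y}"
  shows "(x, y) \<in> (adjacency ends (C - {e}))\<^sup>*"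
proof -
  obtain vs es where W: "simple_walk ends vs es" "e \<notin> set es" "ends e = {hd vs, last vs}" "C = insert e (set es)"
    using assms is_cycle_iff_walk[of ends C e] by blast
  have "(hd vs, last vs) \<in> (adjacency ends (C - {e}))\<^sup>*"
    using W by (intro simple_walk_imp_reachable) auto
  moreover have "hd vs = x \<and> last vs = y \<or> hd vs = y \<and> last vs = x"
    using W(3) assms(3) by (metis doubleton_eq_iff)
  ultimately show ?thesis using sym_adjacency_rtrancl[of ends "C - {e}"] by (metis symD)
qed

lemma cycle_nonempty: "is_cycle ends C \<Longrightarrow> C \<noteq> {}"
  by (auto simp: is_cycle_def)

lemma adjacency_rtrancl_detour:
  assumes "(x, y) \<in> (adjacency ends F)\<^sup>*"
    and "\<And>a b e. e \<in> F \<Longrightarrow> e \<notin> F' \<Longrightarrow> ends e = {a, b} \<Longrightarrow> (a, b) \<in> (adjacency ends F')\<^sup>*"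
  shows "(x, y) \<in> (adjacency ends F')\<^sup>*"
proof -
  have "adjacency ends F \<subseteq> (adjacency ends F')\<^sup>*"
  proof (clarsimp simp only: adjacency_def [of ends F] mem_Collect_eq split_paired_all)
    fix a b e assume "e \<in> F" "ends e = {a, b}"
    then show "(a, b) \<in> (adjacency ends F')\<^sup>*"
      using assms(2) by (cases "e \<in> F'") (auto simp: adjacency_def intro: r_into_rtrancl)
  qed
  then have "(adjacency ends F)\<^sup>* \<subseteq> (adjacency ends F')\<^sup>*" by (rule rtrancl_subset_rtrancl)
  then show ?thesis using assms(1) by (rule subsetD)
qed

lemma spanning_connected_remove_cycle_edge:
  assumes "spanning_connected V ends F" "is_cycle ends C" "C \<subseteq> F" "e \<in> C"
  shows "spanning_connected V ends (F - {e})"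
  unfolding spanning_connected_iff_reachable
proof (intro ballI)
  fix u v assume uv: "u \<in> V" "v \<in> V"
  have "(u, v) \<in> (adjacency ends F)\<^sup>*" using assms uv by (simp add: spanning_connected_iff_reachable)
  then show "(u, v) \<in> (adjacency ends (F - {e}))\<^sup>*"
  proof (rule adjacency_rtrancl_detour)
    fix a b e' assume "e' \<in> F" "e' \<notin> F - {e}" "ends e' = {a, b}"
    then have "ends e = {a, b}" by auto
    then have "(a, b) \<in> (adjacency ends (C - {e}))\<^sup>*"
      by (rule cycle_edge_ends_reachable[OF assms(2,4)])
    then show "(a, b) \<in> (adjacency ends (F - {e}))\<^sup>*"
      using adjacency_rtrancl_mono[of "C - {e}" "F - {e}"] assms(3) by blast
  qed
qed

lemma spanning_connected_mono:
  "spanning_connected V ends F \<Longrightarrow> F \<subseteq> F' \<Longrightarrow> spanning_connected V ends F'"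
  using adjacency_rtrancl_mono[of F F' ends] unfolding spanning_connected_iff_reachable by blast

lemma spanning_tree_exists:
  assumes "finite E" "spanning_connected V ends E"
  shows "spanning_trees V E ends \<noteq> {}"
proof -
  obtain F where F: "F \<subseteq> E" "spanning_connected V ends F"
    and min: "\<And>F'. F' \<subseteq> E \<Longrightarrow> spanning_connected V ends F' \<Longrightarrow> card F \<le> card F'"
    using ex_has_least_nat[of "\<lambda>F. F \<subseteq> E \<and> spanning_connected V ends F" E card] assms by blast
  have "\<not> is_cycle ends C" if C: "C \<subseteq> F" for C
  proof
    assume "is_cycle ends C"
    then obtain e where e: "e \<in> C" using cycle_nonempty by blast
    have "spanning_connected V ends (F - {e})"
      using spanning_connected_remove_cycle_edge[OF F(2) \<open>is_cycle ends C\<close> C e] .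
    then have "card F \<le> card (F - {e})" using min F by blast
    moreover have "finite F" using F assms finite_subset by blast
    ultimately show False using e C by (metis card_Diff1_less leD subsetD)
  qed
  then show ?thesis using F by (auto simp: spanning_trees_def)
qed

text \<open>
  As \<open>T\<close> has no cycle, two different cycles in \<open>T + e\<close> would both use \<open>e\<close>, and an edge \<open>a\<close> of one that the other avoids
  would then have its ends joined in \<open>T - a\<close>, first along its own cycle and around \<open>e\<close> along the
  other.
\<close>

lemma fundamental_cycle_unique:
  assumes T: "\<not> (\<exists>C\<subseteq>T. is_cycle ends C)" and ends: "\<And>a. a \<in> T \<Longrightarrow> \<exists>x y. ends a = {x, y}"
    and C: "C \<subseteq> insert e T" "is_cycle ends C" and D: "D \<subseteq> insert e T" "is_cycle ends D"
  shows "C = D"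
proof -
  have sub: "C \<subseteq> D" if C: "C \<subseteq> insert e T" "is_cycle ends C" and D: "D \<subseteq> insert e T" "is_cycle ends D" for C D
  proof
    fix a assume a: "a \<in> C"
    show "a \<in> D"
    proof (rule ccontr)
      assume aD: "a \<notin> D"
      have eD: "e \<in> D" using D T by blast
      then have aT: "a \<in> T" using a aD C by auto
      then obtain x y where xy: "ends a = {x, y}" using ends by blast
      have "(x, y) \<in> (adjacency ends (C - {a}))\<^sup>*" using cycle_edge_ends_reachable C a xy by metis
      then have "(x, y) \<in> (adjacency ends (T - {a}))\<^sup>*"
      proof (rule adjacency_rtrancl_detour)
        fix u v e' assume "e' \<in> C - {a}" "e' \<notin> T - {a}" and uv: "ends e' = {u, v}"
        then have "e' = e" using C by blast
        then have "(u, v) \<in> (adjacency ends (D - {e}))\<^sup>*"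
          using cycle_edge_ends_reachable[OF D(2) eD] uv by metis
        then show "(u, v) \<in> (adjacency ends (T - {a}))\<^sup>*"
          using adjacency_rtrancl_mono[of "D - {e}" "T - {a}" ends] D aD by blast
      qed
      then show False using cycle_through_edge[of x y ends "T - {a}" a] xy T aT by (metis Diff_iff insert_Diff singletonI)
    qed
  qed
  show ?thesis using sub C D by blast
qed

lemma cycle_of_eq:
  assumes "U \<in> spanning_unicycles V E ends" "C \<subseteq> U" "is_cycle ends C"
  shows "cycle_of ends U = C"
proof -
  have "\<exists>!C. C \<subseteq> U \<and> is_cycle ends C" using assms(1) by (simp add: spanning_unicycles_def)
  then show ?thesis unfolding cycle_of_def using assms(2,3) by (intro the1_equality) auto
qed

lemma cycle_of_unicycle:
  assumes "U \<in> spanning_unicycles V E ends"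
  shows "cycle_of ends U \<subseteq> U" "is_cycle ends (cycle_of ends U)"
proof -
  obtain C where "C \<subseteq> U" "is_cycle ends C" using assms unfolding spanning_unicycles_def by blast
  then show "cycle_of ends U \<subseteq> U" "is_cycle ends (cycle_of ends U)" using cycle_of_eq[OF assms] by auto
qed

lemma tree_insert_unicycle:
  assumes wf: "\<And>a. a \<in> E \<Longrightarrow> \<exists>x\<in>V. \<exists>y\<in>V. ends a = {x, y}"
    and T: "T \<in> spanning_trees V E ends" and e: "e \<in> E - T"
  shows "insert e T \<in> spanning_unicycles V E ends" "e \<in> cycle_of ends (insert e T)"
proof -
  obtain x y where xy: "x \<in> V" "y \<in> V" "ends e = {x, y}" using wf e by blast
  have TT: "T \<subseteq> E" "spanning_connected V ends T" "\<not> (\<exists>C\<subseteq>T. is_cycle ends C)"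
    using T by (auto simp: spanning_trees_def)
  have "(x, y) \<in> (adjacency ends T)\<^sup>*" using TT xy by (auto simp: spanning_connected_iff_reachable)
  then obtain C where C: "C \<subseteq> insert e T" "is_cycle ends C" "e \<in> C"
    using cycle_through_edge[of x y ends T e] xy(3) e by (meson DiffD2)
  have "\<exists>x y. ends a = {x, y}" if "a \<in> T" for a using wf[of a] that TT(1) by auto
  then have "D = C" if "D \<subseteq> insert e T" "is_cycle ends D" for D
    by (rule fundamental_cycle_unique[OF TT(3) _ that C(1,2)])
  then have "\<exists>!C. C \<subseteq> insert e T \<and> is_cycle ends C"
    using C(1,2) by metis
  then show U: "insert e T \<in> spanning_unicycles V E ends"
    unfolding spanning_unicycles_def mem_Collect_eq
    using TT(1) e spanning_connected_mono[OF TT(2) subset_insertI] by (intro conjI) auto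
  show "e \<in> cycle_of ends (insert e T)" using cycle_of_eq[OF U C(1,2)] C by simp
qed

lemma unicycle_remove_tree:
  assumes U: "U \<in> spanning_unicycles V E ends" and e: "e \<in> cycle_of ends U"
  shows "U - {e} \<in> spanning_trees V E ends"
proof -
  have "\<not> is_cycle ends C" if "C \<subseteq> U - {e}" for C
    using that e cycle_of_eq[OF U, of C] by blast
  moreover have "spanning_connected V ends (U - {e})"
    using spanning_connected_remove_cycle_edge[of V ends U] cycle_of_unicycle[OF U] e U
    by (auto simp: spanning_unicycles_def)
  ultimately show ?thesis using U by (auto simp: spanning_trees_def spanning_unicycles_def)
qed

text \<open>
  Deleting a given edge \<open>e\<close> of the cycle and adding it back are inverse to each other. This is the
  exchange that turns sums over unicycles through \<open>e\<close> into sums over trees avoiding \<open>e\<close>.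
\<close>

lemma sum_unicycles_through_edge:
  fixes g :: "'e set \<Rightarrow> real"
  assumes wf: "\<And>a. a \<in> E \<Longrightarrow> \<exists>x\<in>V. \<exists>y\<in>V. ends a = {x, y}" and "finite E" "e \<in> E"
  shows "(\<Sum>U | U \<in> spanning_unicycles V E ends \<and> e \<in> cycle_of ends U. weight c U * g U) =
         c e * (\<Sum>T | T \<in> spanning_trees V E ends \<and> e \<notin> T. weight c T * g (insert e T))"
proof -
  have "(\<Sum>T | T \<in> spanning_trees V E ends \<and> e \<notin> T. weight c (insert e T) * g (insert e T)) =
    (\<Sum>U | U \<in> spanning_unicycles V E ends \<and> e \<in> cycle_of ends U. weight c U * g U)"
  proof (rule sum.reindex_bij_witness[where i = "\<lambda>U. U - {e}" and j = "insert e"])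
    fix U assume U: "U \<in> {U. U \<in> spanning_unicycles V E ends \<and> e \<in> cycle_of ends U}"
    then have "e \<in> U" using cycle_of_unicycle by blast
    then show "insert e (U - {e}) = U" by blast
    show "U - {e} \<in> {T. T \<in> spanning_trees V E ends \<and> e \<notin> T}" using unicycle_remove_tree U by auto
  next
    fix T assume "T \<in> {T. T \<in> spanning_trees V E ends \<and> e \<notin> T}"
    then show "insert e T \<in> {U. U \<in> spanning_unicycles V E ends \<and> e \<in> cycle_of ends U}"
      using tree_insert_unicycle[where T = T and e = e, OF wf] assms by auto
  qed auto
  moreover have "weight c (insert e T) = c e * weight c T" if "T \<in> spanning_trees V E ends" "e \<notin> T" for T
  proof -
    have "finite T" using that assms finite_subset by (auto simp: spanning_trees_def)
    then show ?thesis using that by (simp add: weight_def)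
  qed
  ultimately show ?thesis by (simp add: sum_distrib_left mult.assoc)
qed

section \<open>Cycles of a plane graph are Jordan curves\<close>

locale plane_multigraph =
  fixes V :: "complex set" and E :: "'e set" and \<gamma> :: "'e \<Rightarrow> real \<Rightarrow> complex"
  assumes plane: "plane_graph V E \<gamma>"
begin

abbreviation ends :: "'e \<Rightarrow> complex set" where "ends \<equiv> curve_ends \<gamma>"

definition curve :: "'e set \<Rightarrow> complex set" where
  "curve F = (\<Union>e\<in>F. path_image (\<gamma> e))"

definition open_edge :: "'e \<Rightarrow> complex set" where
  "open_edge e = \<gamma> e ` {0<..<1}"

lemma finite_V: "finite V" and V_nonempty: "V \<noteq> {}" and finite_E: "finite E"
  using plane by (auto simp: plane_graph_def)

lemma edge_simple_path: "e \<in> E \<Longrightarrow> simple_path (\<gamma> e)"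
  using plane by (auto simp: plane_graph_def)

lemma edge_ends_in_V: "e \<in> E \<Longrightarrow> \<exists>x\<in>V. \<exists>y\<in>V. ends e = {x, y}"
  using plane unfolding plane_graph_def curve_ends_def
  by (intro bexI[of _ "pathstart (\<gamma> e)"] bexI[of _ "pathfinish (\<gamma> e)"]) auto

lemma path_image_eq: "path_image (\<gamma> e) = open_edge e \<union> ends e"
proof -
  have "{0..1} = insert 0 (insert 1 {0<..<1::real})" by auto
  then show ?thesis
    by (auto simp: path_image_def open_edge_def curve_ends_def pathstart_def pathfinish_def)
qed

lemma open_edge_disjoint_V: "e \<in> E \<Longrightarrow> open_edge e \<inter> V = {}"
  using plane by (auto simp: plane_graph_def open_edge_def)

lemma open_edge_disjoint_edge:
  "e \<in> E \<Longrightarrow> e' \<in> E \<Longrightarrow> e \<noteq> e' \<Longrightarrow> open_edge e \<inter> path_image (\<gamma> e') = {}"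
  using plane by (auto simp: plane_graph_def open_edge_def)

lemma open_edge_disjoint_curve:
  "e \<in> E \<Longrightarrow> F \<subseteq> E \<Longrightarrow> e \<notin> F \<Longrightarrow> open_edge e \<inter> curve F = {}"
  using open_edge_disjoint_edge[of e] by (fastforce simp: curve_def)

lemma edges_meet_at_ends:
  assumes "e \<in> E" "e' \<in> E" "e \<noteq> e'"
  shows "path_image (\<gamma> e) \<inter> path_image (\<gamma> e') \<subseteq> ends e \<inter> ends e'"
  using open_edge_disjoint_edge[of e e'] open_edge_disjoint_edge[of e' e] assms
  by (auto simp: path_image_eq)

lemma edge_Int_V: "e \<in> E \<Longrightarrow> path_image (\<gamma> e) \<inter> V \<subseteq> ends e"
  using open_edge_disjoint_V[of e] by (auto simp: path_image_eq)

lemma ends_subset_V: "e \<in> E \<Longrightarrow> ends e \<subseteq> V"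
  using edge_ends_in_V by fastforce

lemma compact_edge: "e \<in> E \<Longrightarrow> compact (path_image (\<gamma> e))"
  using edge_simple_path compact_simple_path_image by blast

lemma compact_curve: "F \<subseteq> E \<Longrightarrow> compact (curve F)"
  unfolding curve_def using compact_edge finite_E finite_subset by (intro compact_UN) blast+

lemma continuous_edge: "e \<in> E \<Longrightarrow> continuous_on {0..1} (\<gamma> e)"
  using edge_simple_path[of e] by (simp add: simple_path_def path_def)

lemma connected_open_edge: "e \<in> E \<Longrightarrow> connected (open_edge e)"
  unfolding open_edge_def
  by (rule connected_continuous_image)
     (auto intro: continuous_on_subset[OF continuous_edge])

lemma edge_subset_closure_open_edge: "e \<in> E \<Longrightarrow> path_image (\<gamma> e) \<subseteq> closure (open_edge e)"
proof -
  assume e: "e \<in> E"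
  have "\<gamma> e ` closure {0<..<1} \<subseteq> closure (open_edge e)"
    using continuous_edge[OF e] by (intro image_closure_subset) (auto simp: open_edge_def closure_subset)
  then show ?thesis by (simp add: path_image_def)
qed

lemma edge_oriented_arc:
  assumes "e \<in> E" "ends e = {a, b}" "a \<noteq> b"
  obtains g where "arc g" "pathstart g = a" "pathfinish g = b" "path_image g = path_image (\<gamma> e)"
proof -
  have *: "pathstart (\<gamma> e) = a \<and> pathfinish (\<gamma> e) = b \<or> pathstart (\<gamma> e) = b \<and> pathfinish (\<gamma> e) = a"
    using assms(2) by (auto simp: curve_ends_def doubleton_eq_iff)
  then have "arc (\<gamma> e)" using assms edge_simple_path[of e] by (auto simp: arc_simple_path)
  from * show ?thesis
  proof
    assume "pathstart (\<gamma> e) = a \<and> pathfinish (\<gamma> e) = b"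
    then show ?thesis using that[of "\<gamma> e"] \<open>arc (\<gamma> e)\<close> by simp
  next
    assume "pathstart (\<gamma> e) = b \<and> pathfinish (\<gamma> e) = a"
    then show ?thesis using that[of "reversepath (\<gamma> e)"] \<open>arc (\<gamma> e)\<close> by (simp add: arc_reversepath)
  qed
qed

lemma walk_ends_subset:
  assumes "simple_walk ends vs es" "e \<in> set es"
  shows "ends e \<subseteq> set vs"
proof -
  obtain i where "i < length es" "es ! i = e" using assms by (auto simp: in_set_conv_nth)
  then show ?thesis using assms by (auto simp: simple_walk_def)
qed

lemma simple_walk_arc:
  assumes "simple_walk ends vs es" "set es \<subseteq> E" "es \<noteq> []"
  shows "\<exists>g. arc g \<and> pathstart g = hd vs \<and> pathfinish g = last vs \<and> path_image g = curve (set es)"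
  using assms
proof (induction es arbitrary: vs)
  case (Cons e es)
  then obtain v ws where vs: "vs = v # ws" "v \<notin> set ws" "ends e = {v, hd ws}" "simple_walk ends ws es"
    by (auto simp: simple_walk_Cons)
  have ws: "ws \<noteq> []" using simple_walk_ne[OF vs(4)] .
  then have "v \<noteq> hd ws" using vs(2) hd_in_set by metis
  then obtain g where g: "arc g" "pathstart g = v" "pathfinish g = hd ws" "path_image g = path_image (\<gamma> e)"
    using edge_oriented_arc[of e v "hd ws"] vs Cons.prems by auto
  show ?case
  proof (cases "es = []")
    case True
    then show ?thesis using g vs by (intro exI[of _ g]) (auto simp: simple_walk_Nil curve_def)
  next
    case False
    then obtain g' where g': "arc g'" "pathstart g' = hd ws" "pathfinish g' = last ws"
      "path_image g' = curve (set es)"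
      using Cons.IH[OF vs(4)] Cons.prems by auto
    have "path_image g \<inter> path_image g' \<subseteq> {pathstart g'}"
    proof
      fix z assume z: "z \<in> path_image g \<inter> path_image g'"
      then obtain e' where e': "e' \<in> set es" "z \<in> path_image (\<gamma> e')" using g' by (auto simp: curve_def)
      have "e' \<noteq> e" using walk_ends_subset[OF vs(4) e'(1)] vs(2,3) by auto
      then have "z \<in> ends e \<inter> ends e'"
        using edges_meet_at_ends[of e e'] e' Cons.prems z g by auto
      then show "z \<in> {pathstart g'}"
        using walk_ends_subset[OF vs(4) e'(1)] vs(2,3) g' by auto
    qed
    then have "arc (g +++ g')" using g g' by (intro arc_join) auto
    then show ?thesis using g g' vs ws by (intro exI[of _ "g +++ g'"]) (auto simp: path_image_join curve_def)
  qed
qed simp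

lemma cycle_Jordan_curve:
  assumes "is_cycle ends C" "C \<subseteq> E" "e \<in> C"
  shows "\<exists>g. simple_path g \<and> pathfinish g = pathstart g \<and> path_image g = curve C"
    and "connected (curve (C - {e}) \<union> ends e)"
proof -
  obtain vs es where W: "simple_walk ends vs es" "e \<notin> set es" "ends e = {hd vs, last vs}" "C = insert e (set es)"
    using assms is_cycle_iff_walk[of ends C e] by blast
  have C_e: "C - {e} = set es" using W by auto
  have "(\<exists>g. simple_path g \<and> pathfinish g = pathstart g \<and> path_image g = curve C) \<and>
    connected (curve (C - {e}) \<union> ends e)"
  proof (cases "es = []")
    case True
    then obtain v where v: "vs = [v]" using W by (auto simp: simple_walk_Nil)
    have "pathfinish (\<gamma> e) = pathstart (\<gamma> e)" using W v by (auto simp: curve_ends_def)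
    moreover have "connected {v}" by simp
    ultimately show ?thesis using W v C_e True assms edge_simple_path[of e]
      by (intro conjI exI[of _ "\<gamma> e"]) (auto simp: curve_def)
  next
    case False
    obtain g where g: "arc g" "pathstart g = hd vs" "pathfinish g = last vs" "path_image g = curve (set es)"
      using simple_walk_arc[OF W(1) _ False] W assms by auto
    have ne: "last vs \<noteq> hd vs" using g arc_distinct_ends by metis
    obtain g' where g': "arc g'" "pathstart g' = last vs" "pathfinish g' = hd vs" "path_image g' = path_image (\<gamma> e)"
      using edge_oriented_arc[of e "last vs" "hd vs"] W assms ne by (auto simp: insert_commute)
    have "path_image g \<inter> path_image g' \<subseteq> {pathstart g, pathstart g'}"
    proof
      fix z assume z: "z \<in> path_image g \<inter> path_image g'"
      then obtain e' where e': "e' \<in> set es" "z \<in> path_image (\<gamma> e')" using g by (auto simp: curve_def)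
      then have "z \<in> ends e" using edges_meet_at_ends[of e e'] W assms z g' by auto
      then show "z \<in> {pathstart g, pathstart g'}" using W g g' by auto
    qed
    then have "simple_path (g +++ g')" using g g' by (intro simple_path_join_loop) auto
    moreover have "path_image (g +++ g') = curve C" using g g' W by (auto simp: path_image_join curve_def)
    moreover have "curve (C - {e}) \<union> ends e = path_image g"
      using g W C_e pathstart_in_path_image[of g] pathfinish_in_path_image[of g] by auto
    ultimately show ?thesis using g g' connected_arc_image[OF g(1)]
      by (intro conjI exI[of _ "g +++ g'"]) auto
  qed
  then show "\<exists>g. simple_path g \<and> pathfinish g = pathstart g \<and> path_image g = curve C"
    and "connected (curve (C - {e}) \<union> ends e)" by auto
qed

lemma cycle_inside_outside:
  assumes "is_cycle ends C" "C \<subseteq> E" and X: "X \<in> {inside (curve C), outside (curve C)}"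
  shows "open X" "connected X" "frontier X = curve C" "X \<subseteq> - curve C" "X \<noteq> {}"
    "\<And>x y. connected_component (- curve C) x y \<Longrightarrow> x \<in> X \<Longrightarrow> y \<in> X"
proof -
  obtain e where "e \<in> C" using assms cycle_nonempty by blast
  then obtain g where g: "simple_path g" "pathfinish g = pathstart g" "path_image g = curve C"
    using cycle_Jordan_curve[OF assms(1,2)] by blast
  note J = Jordan_inside_outside[OF g(1,2), unfolded g(3)]
  show "open X" "connected X" "frontier X = curve C" "X \<noteq> {}" using J X by auto
  show "X \<subseteq> - curve C" using X inside_no_overlap[of "curve C"] outside_no_overlap[of "curve C"] by blast
  show "\<And>x y. connected_component (- curve C) x y \<Longrightarrow> x \<in> X \<Longrightarrow> y \<in> X"
    using X inside_same_component outside_same_component by blast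
qed

section \<open>The two faces along an edge\<close>

definition drawing :: "complex set" where
  "drawing = V \<union> curve E"

lemma faces_eq: "faces V E \<gamma> = components (- drawing)"
  by (simp add: faces_def drawing_def curve_def)

lemma compact_drawing: "compact drawing"
  unfolding drawing_def using compact_curve[of E] finite_V by (auto intro: finite_imp_compact)

lemma face_open: "f \<in> faces V E \<gamma> \<Longrightarrow> open f"
  using compact_drawing open_components[of "- drawing"] by (auto simp: faces_eq compact_imp_closed open_Compl)

lemma face_connected: "f \<in> faces V E \<gamma> \<Longrightarrow> connected f"
  by (simp add: faces_eq in_components_connected)

lemma face_nonempty: "f \<in> faces V E \<gamma> \<Longrightarrow> f \<noteq> {}"
  by (simp add: faces_eq in_components_nonempty)

lemma face_subset: "f \<in> faces V E \<gamma> \<Longrightarrow> f \<subseteq> - drawing"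
  by (simp add: faces_eq in_components_subset)

lemma face_eqI: "f \<in> faces V E \<gamma> \<Longrightarrow> f' \<in> faces V E \<gamma> \<Longrightarrow> z \<in> f \<Longrightarrow> z \<in> f' \<Longrightarrow> f = f'"
  using components_eq[of f "- drawing" f'] by (auto simp: faces_eq)

lemma face_exists: "z \<notin> drawing \<Longrightarrow> \<exists>f\<in>faces V E \<gamma>. z \<in> f"
  using Union_components[of "- drawing"] unfolding faces_eq by blast

lemma curve_subset_drawing: "F \<subseteq> E \<Longrightarrow> curve F \<subseteq> drawing"
  by (auto simp: drawing_def curve_def)

text \<open>
  Let \<open>J\<close> be the Jordan curve and \<open>R\<close> the drawing without a small open piece of \<open>e\<close> around \<open>p\<close>. Two
  points near \<open>p\<close> on the same side of \<open>J\<close> are separated neither by \<open>J\<close> nor by \<open>R\<close>, and \<open>J \<inter> R\<close> is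
  \<open>J\<close> without an open arc, hence connected. By Janiszewski's theorem they are not separated by
  \<open>J \<union> R\<close>, which is the whole drawing, so they lie in the same face.
\<close>

lemma edge_side_locally_one_face:
  assumes C: "is_cycle ends C" "C \<subseteq> E" "e \<in> C" and p: "p \<in> open_edge e"
    and X: "X \<in> {inside (curve C), outside (curve C)}"
  shows "\<exists>f\<in>faces V E \<gamma>. \<exists>r>0. f \<subseteq> X \<and> ball p r \<inter> X \<subseteq> f"
proof -
  note X_props = cycle_inside_outside[OF C(1,2) X]
  have e: "e \<in> E" using C by auto
  obtain t where t: "0 < t" "t < 1" "p = \<gamma> e t" using p by (auto simp: open_edge_def)
  define R where "R = curve (C - {e}) \<union> ends e"
  define L1 where "L1 = \<gamma> e ` {0..t/2}"
  define L2 where "L2 = \<gamma> e ` {(1+t)/2..1}"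
  \<comment> \<open>the Jordan curve without a small open piece of \<open>e\<close> around \<open>p\<close>\<close>
  define B where "B = R \<union> L1 \<union> L2"
  define rest where "rest = B \<union> V \<union> curve (E - {e})"
  have cont: "continuous_on {0..t/2} (\<gamma> e)" "continuous_on {(1+t)/2..1} (\<gamma> e)"
    using continuous_edge[OF e] t by (auto intro: continuous_on_subset)
  have L: "connected L1" "connected L2" "compact L1" "compact L2"
    unfolding L1_def L2_def using cont
    by (auto intro: connected_continuous_image compact_continuous_image)
  have "\<gamma> e 0 \<in> L1" "\<gamma> e 1 \<in> L2" unfolding L1_def L2_def using t by auto
  moreover have "\<gamma> e 0 \<in> R" "\<gamma> e 1 \<in> R"
    by (auto simp: R_def curve_ends_def pathstart_def pathfinish_def)
  moreover have "connected R" using cycle_Jordan_curve[OF C] by (simp add: R_def)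
  ultimately have conn_B: "connected B"
    unfolding B_def using L by (intro connected_Un) auto
  have comp_R: "compact R"
    unfolding R_def curve_ends_def using compact_curve[of "C - {e}"] C by (intro compact_Un) auto
  have closed_rest: "closed rest"
    unfolding rest_def B_def using comp_R L compact_curve[of "E - {e}"] finite_V
    by (intro closed_Un) (auto intro: compact_imp_closed finite_imp_closed)
  have L_sub: "L1 \<subseteq> path_image (\<gamma> e)" "L2 \<subseteq> path_image (\<gamma> e)"
    using t by (auto simp: L1_def L2_def path_image_def)
  have curve_C: "curve C = curve (C - {e}) \<union> path_image (\<gamma> e)"
    using C by (auto simp: curve_def)
  have Int: "curve C \<inter> rest = B"
  proof
    show "B \<subseteq> curve C \<inter> rest"
      using L_sub curve_C by (auto simp: B_def R_def rest_def path_image_eq)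
    have "z \<in> ends e" if "z \<in> path_image (\<gamma> e)" "z \<in> V \<union> curve (E - {e})" for z
      using that edge_Int_V[OF e] edges_meet_at_ends[OF e] by (fastforce simp: curve_def)
    then show "curve C \<inter> rest \<subseteq> B"
      unfolding curve_C by (auto simp: rest_def B_def R_def)
  qed
  have inj: "\<gamma> e s \<noteq> p" if "s \<in> {0..1}" "s \<noteq> t" for s
  proof
    assume "\<gamma> e s = p"
    moreover have "s = t \<or> s = 0 \<and> t = 1 \<or> s = 1 \<and> t = 0" if "\<gamma> e s = \<gamma> e t"
      using edge_simple_path[OF e] that \<open>s \<in> {0..1}\<close> t unfolding simple_path_def loop_free_def by force
    ultimately show False using that t by simp
  qed
  have p_rest: "p \<notin> rest"
  proof -
    have "p \<notin> L1" "p \<notin> L2" unfolding L1_def L2_def using inj t by (auto simp: image_iff) (smt (verit) atLeastAtMost_iff field_sum_of_halves)+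
    moreover have "p \<notin> R"
      using open_edge_disjoint_curve[OF e, of "C - {e}"] C p ends_subset_V[OF e] open_edge_disjoint_V[OF e]
      by (auto simp: R_def)
    ultimately show ?thesis
      using open_edge_disjoint_curve[OF e, of "E - {e}"] p open_edge_disjoint_V[OF e]
      by (auto simp: rest_def B_def)
  qed
  have Un: "curve C \<union> rest = drawing"
    using C L_sub e ends_subset_V[OF e] by (auto simp: drawing_def rest_def curve_def B_def R_def)
  obtain r where r: "r > 0" "ball p r \<subseteq> - rest"
    using closed_rest p_rest by (metis ComplI open_Compl open_contains_ball)
  have "p \<in> frontier X" using p X_props(3) C by (auto simp: curve_def path_image_eq)
  then obtain a where a: "a \<in> X" "a \<in> ball p r"
    using r(1) by (auto simp: frontier_def closure_approachable dist_commute)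
  have aK: "a \<in> - drawing" using a r X_props(4) unfolding Un[symmetric] by blast
  define f where "f = connected_component_set (- drawing) a"
  have f: "f \<in> faces V E \<gamma>" using aK by (auto simp: faces_eq f_def components_def)
  moreover have "f \<subseteq> X"
  proof
    fix b assume "b \<in> f"
    then have "connected_component (- drawing) a b" by (simp add: f_def)
    then have "connected_component (- curve C) a b"
      using curve_subset_drawing[OF C(2)] by (auto intro: connected_component_of_subset)
    then show "b \<in> X" using X_props(6) a by blast
  qed
  moreover have "ball p r \<inter> X \<subseteq> f"
  proof
    fix b assume b: "b \<in> ball p r \<inter> X"
    have "connected_component (- (curve C \<union> rest)) a b"
    proof (rule Janiszewski)
      show "compact (curve C)" "closed rest" "connected (curve C \<inter> rest)"
        using compact_curve C closed_rest Int conn_B by auto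
      show "connected_component (- curve C) a b"
        using X_props a b by (intro connected_componentI[of X]) auto
      show "connected_component (- rest) a b"
        using r a b by (intro connected_componentI[of "ball p r"]) auto
    qed
    then show "b \<in> f" by (simp add: Un f_def)
  qed
  ultimately show ?thesis using r by blast
qed

text \<open>The face found near \<open>p\<close> does not change as \<open>p\<close> moves along the connected open edge.\<close>

lemma edge_side_one_face:
  assumes C: "is_cycle ends C" "C \<subseteq> E" "e \<in> C"
    and X: "X \<in> {inside (curve C), outside (curve C)}"
  shows "\<exists>f\<in>faces V E \<gamma>. f \<subseteq> X \<and> (\<forall>p\<in>open_edge e. \<exists>r>0. ball p r \<inter> X \<subseteq> f)"
proof -
  note X_props = cycle_inside_outside[OF C(1,2) X]
  have e: "e \<in> E" using C by auto
  obtain F where F: "\<And>p. p \<in> open_edge e \<Longrightarrow> F p \<in> faces V E \<gamma> \<and> F p \<subseteq> X \<and> (\<exists>r>0. ball p r \<inter> X \<subseteq> F p)"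
    using edge_side_locally_one_face[OF C _ X] by metis
  have const: "F a = F b" if "a \<in> open_edge e" "b \<in> open_edge e" for a b
  proof (rule connected_equivalence_relation[OF connected_open_edge[OF e] that, where R = "\<lambda>a b. F a = F b"])
    fix p assume p: "p \<in> open_edge e"
    obtain r where r: "r > 0" "ball p r \<inter> X \<subseteq> F p" using F[OF p] by blast
    have "F p = F q" if q: "q \<in> open_edge e \<inter> ball p r" for q
    proof -
      obtain s where s: "s > 0" "ball q s \<inter> X \<subseteq> F q" using F[of q] q by blast
      have "q \<in> closure X" using q X_props(3) C by (auto simp: frontier_def curve_def path_image_eq)
      moreover have "q \<in> ball q s \<inter> ball p r" using q s by auto
      ultimately have "X \<inter> (ball q s \<inter> ball p r) \<noteq> {}"
        by (metis Int_commute closure_iff_nhds_not_empty open_Int open_ball subset_refl)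
      then obtain z where "z \<in> X \<inter> (ball q s \<inter> ball p r)" by blast
      then have "z \<in> F p" "z \<in> F q" using r s by auto
      then show ?thesis using face_eqI F[OF p] F[of q] q by blast
    qed
    then show "\<exists>T. openin (top_of_set (open_edge e)) T \<and> p \<in> T \<and> (\<forall>q\<in>T. F p = F q)"
      using p r by (intro exI[of _ "open_edge e \<inter> ball p r"]) auto
  qed auto
  have "\<gamma> e (1/2) \<in> open_edge e" by (auto simp: open_edge_def)
  then show ?thesis using const F by metis
qed

text \<open>
  The part of a neighbourhood of \<open>p\<close> off the edge consists of points inside and points outside the
  Jordan curve; near \<open>p\<close> the former all lie in one face and the latter in another, so no third face
  comes close to the edge.
\<close>

lemma cycle_edge_faces:
  assumes C: "is_cycle ends C" "C \<subseteq> E" "e \<in> C"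
  obtains u w where "u \<in> faces V E \<gamma>" "w \<in> faces V E \<gamma>"
    "u \<subseteq> inside (curve C)" "w \<subseteq> outside (curve C)" "dual_ends V E \<gamma> e = {u, w}"
    "\<And>p. p \<in> open_edge e \<Longrightarrow> \<exists>r>0. ball p r \<subseteq> u \<union> w \<union> open_edge e"
proof -
  have e: "e \<in> E" using C by auto
  obtain u where u: "u \<in> faces V E \<gamma>" "u \<subseteq> inside (curve C)"
    "\<And>p. p \<in> open_edge e \<Longrightarrow> \<exists>r>0. ball p r \<inter> inside (curve C) \<subseteq> u"
    using edge_side_one_face[OF C, of "inside (curve C)"] by auto
  obtain w where w: "w \<in> faces V E \<gamma>" "w \<subseteq> outside (curve C)"
    "\<And>p. p \<in> open_edge e \<Longrightarrow> \<exists>r>0. ball p r \<inter> outside (curve C) \<subseteq> w"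
    using edge_side_one_face[OF C, of "outside (curve C)"] by auto
  have nbhd: "\<exists>r>0. ball p r \<subseteq> u \<union> w \<union> open_edge e" if p: "p \<in> open_edge e" for p
  proof -
    obtain r1 r2 where r12: "r1 > 0" "r2 > 0" "ball p r1 \<inter> inside (curve C) \<subseteq> u"
      "ball p r2 \<inter> outside (curve C) \<subseteq> w" using u(3)[OF p] w(3)[OF p] by blast
    have "closed (V \<union> curve (E - {e}))"
      using compact_curve[of "E - {e}"] finite_V
      by (intro closed_Un) (auto intro: compact_imp_closed finite_imp_closed)
    moreover have "p \<notin> V \<union> curve (E - {e})"
      using open_edge_disjoint_curve[OF e, of "E - {e}"] open_edge_disjoint_V[OF e] p by auto
    ultimately obtain r3 where r3: "r3 > 0" "ball p r3 \<subseteq> - (V \<union> curve (E - {e}))"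
      by (metis ComplI open_Compl open_contains_ball)
    define r where "r = min r1 (min r2 r3)"
    have "z \<in> u \<union> w \<union> open_edge e" if z: "z \<in> ball p r" for z
    proof -
      consider "z \<in> inside (curve C)" | "z \<in> outside (curve C)" | "z \<in> curve C"
        using inside_Un_outside[of "curve C"] by blast
      then show ?thesis
      proof cases
        case 3
        moreover have "curve C \<subseteq> path_image (\<gamma> e) \<union> curve (E - {e})" using C by (auto simp: curve_def)
        ultimately have "z \<in> path_image (\<gamma> e)" using z r3 by (auto simp: r_def)
        then show ?thesis using z r3 ends_subset_V[OF e] by (auto simp: r_def path_image_eq)
      qed (use z r12 in \<open>auto simp: r_def\<close>)
    qed
    then have "ball p r \<subseteq> u \<union> w \<union> open_edge e" by blast
    moreover have "r > 0" using r12 r3 by (simp add: r_def)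
    ultimately show ?thesis by blast
  qed
  have in_ends: "f \<in> dual_ends V E \<gamma> e"
    if f: "f \<in> faces V E \<gamma>" and X: "X \<in> {inside (curve C), outside (curve C)}"
      and fX: "\<And>p. p \<in> open_edge e \<Longrightarrow> \<exists>r>0. ball p r \<inter> X \<subseteq> f" for f X
  proof -
    note X_props = cycle_inside_outside[OF C(1,2) X]
    have "p \<in> closure f" if p: "p \<in> open_edge e" for p
    proof -
      obtain r where r: "r > 0" "ball p r \<inter> X \<subseteq> f" using fX[OF p] by blast
      have "p \<in> closure X" using p X_props(3) C by (auto simp: frontier_def curve_def path_image_eq)
      then have "p \<in> closure (ball p r \<inter> X)" using r
        by (metis IntI centre_in_ball open_Int_closure_subset open_ball subsetD)
      then show ?thesis using closure_mono[OF r(2)] by blast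
    qed
    then have "closure (open_edge e) \<subseteq> closure f" by (intro closure_minimal) auto
    then have "path_image (\<gamma> e) \<subseteq> closure f" using edge_subset_closure_open_edge[OF e] by blast
    moreover have "path_image (\<gamma> e) \<inter> f = {}"
      using face_subset[OF f] e by (auto simp: drawing_def curve_def)
    ultimately show ?thesis
      using f face_open[OF f] by (auto simp: dual_ends_def frontier_def interior_open)
  qed
  have "f \<in> {u, w}" if "f \<in> dual_ends V E \<gamma> e" for f
  proof -
    have f: "f \<in> faces V E \<gamma>" "path_image (\<gamma> e) \<subseteq> frontier f" using that by (auto simp: dual_ends_def)
    have p: "\<gamma> e (1/2) \<in> open_edge e" by (auto simp: open_edge_def)
    then obtain r where r: "r > 0" "ball (\<gamma> e (1/2)) r \<subseteq> u \<union> w \<union> open_edge e" using nbhd by blast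
    have "\<gamma> e (1/2) \<in> closure f" using f p by (auto simp: frontier_def path_image_eq)
    then obtain z where z: "z \<in> f" "z \<in> ball (\<gamma> e (1/2)) r"
      using r(1) by (auto simp: closure_approachable dist_commute)
    have "z \<notin> open_edge e" using face_subset[OF f(1)] z e by (auto simp: drawing_def curve_def path_image_eq)
    then have "z \<in> u \<or> z \<in> w" using z r by auto
    then show ?thesis using face_eqI f z u w by blast
  qed
  then have "dual_ends V E \<gamma> e = {u, w}" using in_ends u w by blast
  then show ?thesis using that u w nbhd by blast
qed

text \<open>
  The two faces together with a point of an edge off the cycle form a connected set that misses the
  cycle. This is why the set of enclosed faces can change only across the edges of the cycle.
\<close>

lemma enclosed_across_edge:
  assumes C: "is_cycle ends C" "C \<subseteq> E" and e: "e \<in> E" "e \<notin> C"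
    and uw: "u \<in> dual_ends V E \<gamma> e" "w \<in> dual_ends V E \<gamma> e" and u: "u \<subseteq> inside (curve C)"
  shows "w \<subseteq> inside (curve C)"
proof -
  have f: "u \<in> faces V E \<gamma>" "path_image (\<gamma> e) \<subseteq> frontier u" "w \<in> faces V E \<gamma>" "path_image (\<gamma> e) \<subseteq> frontier w"
    using uw by (auto simp: dual_ends_def)
  define p where "p = \<gamma> e (1/2)"
  have p: "p \<in> open_edge e" by (auto simp: open_edge_def p_def)
  have conn: "connected (insert p f)" if "f \<in> faces V E \<gamma>" "path_image (\<gamma> e) \<subseteq> frontier f" for f
  proof (rule connected_intermediate_closure[OF face_connected[OF that(1)]])
    have "p \<in> closure f" using that(2) p by (auto simp: frontier_def path_image_eq)
    then show "insert p f \<subseteq> closure f" using closure_subset[of f] by simp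
  qed blast
  have "connected (insert p u \<union> insert p w)" using conn f by (intro connected_Un) auto
  moreover have "insert p u \<union> insert p w \<subseteq> - curve C"
    using face_subset[OF f(1)] face_subset[OF f(3)] curve_subset_drawing[OF C(2)]
      open_edge_disjoint_curve[OF e(1) C(2) e(2)] p by auto
  moreover obtain a where a: "a \<in> u" using face_nonempty f by blast
  ultimately have "connected_component (- curve C) a b" if "b \<in> w" for b
    using that by (intro connected_componentI[of "insert p u \<union> insert p w"]) auto
  then show ?thesis using a u inside_same_component by blast
qed

end

section \<open>A spanning tree does not separate the plane\<close>

lemma edge_leaving_set:
  assumes "(x, y) \<in> (adjacency ends F)\<^sup>*" "x \<in> W" "y \<notin> W"
  shows "\<exists>e\<in>F. \<exists>a b. ends e = {a, b} \<and> a \<in> W \<and> b \<notin> W"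
  using assms
proof (induction rule: rtrancl_induct)
  case (step y z)
  then show ?case by (cases "y \<in> W") (auto simp: adjacency_def)
qed simp

lemma spanning_connected_add_leaf:
  assumes "spanning_connected W ends F" "a \<in> W" "ends e = {a, b}"
  shows "spanning_connected (insert b W) ends (insert e F)"
proof -
  let ?R = "(adjacency ends (insert e F))\<^sup>*"
  have sym: "(y, x) \<in> ?R" if "(x, y) \<in> ?R" for x y
    using that sym_adjacency_rtrancl by (metis symD)
  have "(a, u) \<in> ?R" if "u \<in> insert b W" for u
  proof (cases "u = b")
    case True
    then show ?thesis using assms by (auto simp: adjacency_def intro: r_into_rtrancl)
  next
    case False
    then show ?thesis
      using that assms(1,2) adjacency_rtrancl_mono[of F "insert e F" ends]
      unfolding spanning_connected_iff_reachable by blast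
  qed
  then show ?thesis
    unfolding spanning_connected_iff_reachable using sym by (meson rtrancl_trans)
qed

context plane_multigraph
begin

text \<open>
  The tree is grown edge by edge from one vertex. Each new edge is an arc that meets what is already
  drawn in a single point, so by Janiszewski's theorem the complement stays connected.
\<close>

lemma tree_complement_connected:
  assumes T: "T \<in> spanning_trees V E ends"
  shows "connected (- (V \<union> curve T))"
proof -
  have TE: "T \<subseteq> E" and Tconn: "spanning_connected V ends T" and Tac: "\<not> (\<exists>C\<subseteq>T. is_cycle ends C)"
    using T by (auto simp: spanning_trees_def)
  define grown where "grown = (\<lambda>(W, F). W \<subseteq> V \<and> W \<noteq> {} \<and> F \<subseteq> T \<and> (\<forall>e\<in>F. ends e \<subseteq> W) \<and>
     spanning_connected W ends F \<and> connected (- (W \<union> curve F)))"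
  obtain v0 where v0: "v0 \<in> V" using V_nonempty by blast
  have g0: "grown ({v0}, {})"
    unfolding grown_def prod.case
    using v0 connected_punctured_universe[of v0]
    by (intro conjI) (auto simp: curve_def spanning_connected_iff_reachable)
  have bd: "\<forall>p. grown p \<longrightarrow> card (fst p) < Suc (card V)"
    using finite_V by (auto simp: grown_def less_Suc_eq_le intro: card_mono)
  obtain p where p: "grown p" "\<And>q. grown q \<Longrightarrow> card (fst q) \<le> card (fst p)"
    using ex_has_greatest_nat[OF g0 bd] by metis
  obtain W F where WF: "p = (W, F)" by (cases p)
  have W: "W \<subseteq> V" "W \<noteq> {}" "F \<subseteq> T" "\<And>e. e \<in> F \<Longrightarrow> ends e \<subseteq> W" "spanning_connected W ends F"
    "connected (- (W \<union> curve F))"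
    using p(1) by (auto simp: grown_def WF)
  have "W = V"
  proof (rule ccontr)
    assume "W \<noteq> V"
    then obtain x y where xy: "x \<in> W" "y \<in> V" "y \<notin> W" using W by blast
    then have "(x, y) \<in> (adjacency ends T)\<^sup>*"
      using Tconn W by (auto simp: spanning_connected_iff_reachable)
    then obtain e a b where e: "e \<in> T" "ends e = {a, b}" "a \<in> W" "b \<notin> W"
      using edge_leaving_set[of x y ends T W] xy by blast
    have eE: "e \<in> E" and bV: "b \<in> V" and ab: "a \<noteq> b"
      using e TE ends_subset_V[of e] by auto
    have FE: "F \<subseteq> E" using W TE by blast
    have b_curve: "b \<notin> curve F"
    proof
      assume "b \<in> curve F"
      then obtain e' where "e' \<in> F" "b \<in> path_image (\<gamma> e')" by (auto simp: curve_def)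
      then have "b \<in> ends e'" using edge_Int_V[of e'] FE bV by blast
      then show False using W(4) \<open>e' \<in> F\<close> e by blast
    qed
    have eF: "e \<notin> F" using W(4) e by blast
    let ?D = "W \<union> curve F"
    have "?D \<inter> path_image (\<gamma> e) \<subseteq> ends e"
    proof
      fix z assume z: "z \<in> ?D \<inter> path_image (\<gamma> e)"
      show "z \<in> ends e"
      proof (cases "z \<in> W")
        case True
        then show ?thesis using edge_Int_V[OF eE] W z by blast
      next
        case False
        then obtain e' where "e' \<in> F" "z \<in> path_image (\<gamma> e')" using z by (auto simp: curve_def)
        then show ?thesis using edges_meet_at_ends[OF eE, of e'] z eF FE by auto
      qed
    qed
    then have "?D \<inter> path_image (\<gamma> e) = {a}"
      using e b_curve by (auto simp: path_image_eq)
    then have conn: "connected (?D \<inter> path_image (\<gamma> e))" by simp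
    obtain g where g: "arc g" "path_image g = path_image (\<gamma> e)"
      using edge_oriented_arc[OF eE e(2) ab] by blast
    have "connected (- (?D \<union> path_image (\<gamma> e)))"
    proof (rule Janiszewski_connected[OF _ _ conn W(6)])
      show "compact ?D"
        using compact_curve[OF FE] finite_imp_compact[OF finite_subset[OF W(1) finite_V]] by (rule compact_Un[rotated])
      show "closed (path_image (\<gamma> e))" using compact_edge[OF eE] compact_imp_closed by blast
      show "connected (- path_image (\<gamma> e))" using connected_arc_complement[OF g(1)] g(2) by simp
    qed
    moreover have "?D \<union> path_image (\<gamma> e) = insert b W \<union> curve (insert e F)"
      using e by (auto simp: curve_def path_image_eq)
    ultimately have "connected (- (insert b W \<union> curve (insert e F)))" by metis
    moreover have "\<forall>e'\<in>insert e F. ends e' \<subseteq> insert b W"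
    proof
      fix e' assume "e' \<in> insert e F"
      then consider "e' = e" | "e' \<in> F" by blast
      then show "ends e' \<subseteq> insert b W" using W(4)[of e'] e by cases auto
    qed
    ultimately have "grown (insert b W, insert e F)"
      unfolding grown_def prod.case
      using W(1-3) e(1) bV spanning_connected_add_leaf[OF W(5) e(3,2)] by blast
    then have "card (insert b W) \<le> card W" using p(2) WF by fastforce
    moreover have "finite W" using W finite_V finite_subset by blast
    ultimately show False using e by simp
  qed
  moreover have "F = T"
  proof (rule ccontr)
    assume "F \<noteq> T"
    then obtain e where e: "e \<in> T" "e \<notin> F" using W by blast
    then obtain x y where xy: "x \<in> V" "y \<in> V" "ends e = {x, y}" using TE edge_ends_in_V by blast
    have "(x, y) \<in> (adjacency ends F)\<^sup>*"
      using W(5) xy \<open>W = V\<close> by (auto simp: spanning_connected_iff_reachable)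
    then obtain C where "C \<subseteq> insert e F" "is_cycle ends C"
      using cycle_through_edge xy e by metis
    then show False using Tac W e by blast
  qed
  ultimately show ?thesis using W by simp
qed

lemma fundamental_cycle:
  assumes "T \<in> spanning_trees V E ends" "e \<in> E - T"
  shows "is_cycle ends (cycle_of ends (insert e T))" "cycle_of ends (insert e T) \<subseteq> insert e T"
    "cycle_of ends (insert e T) \<subseteq> E" "e \<in> cycle_of ends (insert e T)"
proof -
  note U = tree_insert_unicycle[OF edge_ends_in_V assms]
  show "is_cycle ends (cycle_of ends (insert e T))" "cycle_of ends (insert e T) \<subseteq> insert e T"
    "e \<in> cycle_of ends (insert e T)"
    using cycle_of_unicycle[OF U(1)] U(2) by auto
  then show "cycle_of ends (insert e T) \<subseteq> E" using assms by (auto simp: spanning_trees_def)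
qed

text \<open>
  Dually, the dual edges of the edges outside \<open>T\<close> connect all faces: a function on the faces that
  takes equal values on the two sides of each of these edges extends to a locally constant function
  on the complement of the tree.
\<close>

lemma constant_across_cotree:
  assumes T: "T \<in> spanning_trees V E ends"
    and h: "\<And>e u w. e \<in> E - T \<Longrightarrow> u \<in> dual_ends V E \<gamma> e \<Longrightarrow> w \<in> dual_ends V E \<gamma> e \<Longrightarrow> h u = h w"
    and uw: "u \<in> faces V E \<gamma>" "w \<in> faces V E \<gamma>"
  shows "h u = h w"
proof -
  \<comment> \<open>a set of values, to avoid choosing one of the faces next to a point on an edge\<close>
  define val where "val z = h ` {f \<in> faces V E \<gamma>. z \<in> closure f}" for z
  let ?O = "- (V \<union> curve T)"
  have TE: "T \<subseteq> E" using T by (auto simp: spanning_trees_def)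
  have val_face: "val z = {h f}" if f: "f \<in> faces V E \<gamma>" and z: "z \<in> f" for z f
  proof -
    have "g = f" if g: "g \<in> faces V E \<gamma>" "z \<in> closure g" for g
    proof -
      have "f \<inter> g \<noteq> {}" using g(2) z open_Int_closure_eq_empty[OF face_open[OF f], of g] by blast
      then show ?thesis using face_eqI f g by blast
    qed
    moreover have "z \<in> closure f" using z closure_subset by blast
    ultimately have "{f \<in> faces V E \<gamma>. z \<in> closure f} = {f}" using f by blast
    then show ?thesis by (simp add: val_def)
  qed
  have locally_constant: "\<exists>N. open N \<and> z \<in> N \<and> (\<forall>y\<in>N \<inter> ?O. val y = val z)" if z: "z \<in> ?O" for z
  proof (cases "z \<in> drawing")
    case False
    then obtain f where f: "f \<in> faces V E \<gamma>" "z \<in> f" using face_exists by blast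
    then show ?thesis using val_face face_open[OF f(1)] by (intro exI[of _ f]) auto
  next
    case True
    then obtain e where e: "e \<in> E" "z \<in> path_image (\<gamma> e)" "e \<notin> T"
      using z by (auto simp: drawing_def curve_def)
    then have ze: "z \<in> open_edge e" using z ends_subset_V[OF e(1)] by (auto simp: path_image_eq)
    have eT: "e \<in> E - T" using e by blast
    obtain a b where ab: "a \<in> faces V E \<gamma>" "b \<in> faces V E \<gamma>" "dual_ends V E \<gamma> e = {a, b}"
      "\<And>p. p \<in> open_edge e \<Longrightarrow> \<exists>r>0. ball p r \<subseteq> a \<union> b \<union> open_edge e"
      by (rule cycle_edge_faces[OF fundamental_cycle(1,3,4)[OF T eT]]) (rule that; assumption)
    have hab: "h a = h b" using h[OF eT] ab by blast
    have val_edge: "val y = {h a}" if y: "y \<in> open_edge e" for y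
    proof -
      have "f = a \<or> f = b" if f: "f \<in> faces V E \<gamma>" "y \<in> closure f" for f
      proof -
        obtain r where r: "r > 0" "ball y r \<subseteq> a \<union> b \<union> open_edge e" using ab(4)[OF y] by blast
        obtain x where x: "x \<in> f" "x \<in> ball y r"
          using f r(1) by (auto simp: closure_approachable dist_commute)
        have "x \<notin> open_edge e" using face_subset[OF f(1)] x e by (auto simp: drawing_def curve_def path_image_eq)
        then have "x \<in> a \<or> x \<in> b" using x r by auto
        then show ?thesis using face_eqI f x ab by blast
      qed
      moreover have "y \<in> closure a"
        using ab(3) y by (auto simp: dual_ends_def frontier_def path_image_eq)
      ultimately have "a \<in> {f \<in> faces V E \<gamma>. y \<in> closure f}" "{f \<in> faces V E \<gamma>. y \<in> closure f} \<subseteq> {a, b}"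
        using ab(1) by auto
      then have "h ` {f \<in> faces V E \<gamma>. y \<in> closure f} \<subseteq> h ` {a, b}" "h a \<in> h ` {f \<in> faces V E \<gamma>. y \<in> closure f}"
        by (intro image_mono imageI; simp)+
      moreover have "h ` {a, b} = {h a}" using hab by simp
      ultimately show ?thesis unfolding val_def by (intro equalityI) simp_all
    qed
    obtain r where r: "r > 0" "ball z r \<subseteq> a \<union> b \<union> open_edge e" using ab(4)[OF ze] by blast
    have "val y = val z" if "y \<in> ball z r" for y
    proof -
      have "y \<in> a \<union> b \<union> open_edge e" using r(2) that by (rule subsetD)
      then consider "y \<in> a" | "y \<in> b" | "y \<in> open_edge e" by blast
      then show ?thesis using val_face[OF ab(1)] val_face[OF ab(2)] val_edge ze hab by cases simp_all
    qed
    moreover have "z \<in> ball z r" using r(1) by simp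
    ultimately show ?thesis using open_ball[of z r] by (metis IntD1)
  qed
  have out: "f \<subseteq> ?O" if "f \<in> faces V E \<gamma>" for f
    using face_subset[OF that] TE by (auto simp: drawing_def curve_def)
  obtain a b where ab: "a \<in> u" "b \<in> w"
    using face_nonempty[OF uw(1)] face_nonempty[OF uw(2)] by auto
  have "val a = val b"
  proof (rule connected_equivalence_relation[OF tree_complement_connected[OF T], where R = "\<lambda>x y. val x = val y"])
    show "a \<in> ?O" "b \<in> ?O" using ab out uw by auto
    fix z assume z: "z \<in> ?O"
    then obtain N where N: "open N" "z \<in> N" "\<And>y. y \<in> N \<inter> ?O \<Longrightarrow> val y = val z"
      using locally_constant[OF z] by metis
    have "openin (top_of_set ?O) (?O \<inter> N)" using N(1) by (rule openin_open_Int)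
    moreover have "\<forall>x\<in>?O \<inter> N. val z = val x" using N(3) by (metis IntI IntD1 IntD2)
    ultimately show "\<exists>S. openin (top_of_set ?O) S \<and> z \<in> S \<and> (\<forall>x\<in>S. val z = val x)"
      using z N(2) by (metis IntI)
  qed auto
  then show ?thesis using val_face[OF uw(1) ab(1)] val_face[OF uw(2) ab(2)] by simp
qed

text \<open>
  Being next to a cotree edge is a property that does not change across cotree edges, so if one face
  has it then all have it; and each cotree edge is next to only two faces.
\<close>

lemma finite_faces:
  assumes T: "T \<in> spanning_trees V E ends"
  shows "finite (faces V E \<gamma>)"
proof -
  have fin: "finite (dual_ends V E \<gamma> e)" if "e \<in> E - T" for e
    by (rule cycle_edge_faces[OF fundamental_cycle(1,3,4)[OF T that]]) simp
  show ?thesis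
  proof (cases "\<exists>e\<in>E - T. dual_ends V E \<gamma> e \<noteq> {}")
    case True
    then obtain e f where ef: "e \<in> E - T" "f \<in> dual_ends V E \<gamma> e" by blast
    let ?h = "\<lambda>u. \<exists>e\<in>E - T. u \<in> dual_ends V E \<gamma> e"
    have "?h u = ?h f" if "u \<in> faces V E \<gamma>" for u
      by (rule constant_across_cotree[OF T _ that]) (use ef in \<open>auto simp: dual_ends_def\<close>)
    then have "faces V E \<gamma> \<subseteq> (\<Union>e\<in>E - T. dual_ends V E \<gamma> e)" using ef by blast
    then show ?thesis using fin finite_E by (meson finite_Diff finite_UN finite_subset)
  next
    case False
    have "u = w" if "u \<in> faces V E \<gamma>" "w \<in> faces V E \<gamma>" for u w
      by (rule constant_across_cotree[OF T _ that, of "\<lambda>x. x"]) (use False in blast)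
    then have "faces V E \<gamma> \<subseteq> {SOME f. f \<in> faces V E \<gamma>}" by (metis singletonI some_in_eq subsetI empty_iff)
    then show ?thesis using finite_subset by blast
  qed
qed

lemma outer_face: "outer_face V E \<gamma> \<in> faces V E \<gamma>" "\<not> bounded (outer_face V E \<gamma>)"
proof -
  have bd: "bounded (- (- drawing))" using compact_drawing compact_imp_bounded by simp
  have "\<exists>!f. f \<in> faces V E \<gamma> \<and> \<not> bounded f"
    using cobounded_unbounded_components[OF bd] cobounded_unique_unbounded_components[OF bd]
    unfolding faces_eq by (metis DIM_complex order_refl)
  then have "outer_face V E \<gamma> \<in> faces V E \<gamma> \<and> \<not> bounded (outer_face V E \<gamma>)"
    unfolding outer_face_def by (rule theI')
  then show "outer_face V E \<gamma> \<in> faces V E \<gamma>" "\<not> bounded (outer_face V E \<gamma>)" by auto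
qed

lemma encloses_iff: "encloses \<gamma> U f \<longleftrightarrow> f \<subseteq> inside (curve (cycle_of ends U))"
  by (simp add: encloses_def curve_def)

lemma unicycle_cycle_subset:
  assumes "U \<in> spanning_unicycles V E ends"
  shows "cycle_of ends U \<subseteq> E"
  using cycle_of_unicycle(1)[OF assms] assms by (auto simp: spanning_unicycles_def)

lemma outer_face_not_enclosed:
  assumes "U \<in> spanning_unicycles V E ends"
  shows "\<not> encloses \<gamma> U (outer_face V E \<gamma>)"
proof -
  have "bounded (inside (curve (cycle_of ends U)))"
    using compact_curve[OF unicycle_cycle_subset[OF assms]] by (intro bounded_inside compact_imp_bounded)
  then show ?thesis using outer_face(2) bounded_subset by (auto simp: encloses_iff)
qed

lemma enclosed_across_non_cycle_edge:
  assumes U: "U \<in> spanning_unicycles V E ends" and e: "e \<in> E" "e \<notin> cycle_of ends U"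
    and uw: "u \<in> dual_ends V E \<gamma> e" "w \<in> dual_ends V E \<gamma> e"
  shows "encloses \<gamma> U u = encloses \<gamma> U w"
  unfolding encloses_iff
  using enclosed_across_edge[OF cycle_of_unicycle(2)[OF U] unicycle_cycle_subset[OF U] e] uw by metis

section \<open>Fundamental cycles invert the dual incidence matrix\<close>

lemma cotree_edge_faces:
  assumes T: "T \<in> spanning_trees V E ends" and e: "e \<in> E - T"
  obtains a b where "a \<in> faces V E \<gamma>" "b \<in> faces V E \<gamma>" "dual_ends V E \<gamma> e = {a, b}"
    "encloses \<gamma> (insert e T) a" "\<not> encloses \<gamma> (insert e T) b"
proof -
  let ?C = "cycle_of ends (insert e T)"
  obtain a b where ab: "a \<in> faces V E \<gamma>" "b \<in> faces V E \<gamma>" "dual_ends V E \<gamma> e = {a, b}"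
    "a \<subseteq> inside (curve ?C)" "b \<subseteq> outside (curve ?C)"
    by (rule cycle_edge_faces[OF fundamental_cycle(1,3,4)[OF T e]])
  have "\<not> b \<subseteq> inside (curve ?C)"
    using ab(5) face_nonempty[OF ab(2)] inside_Int_outside[of "curve ?C"] by blast
  then show ?thesis using ab that by (simp add: encloses_iff)
qed

text \<open>
  In homological terms: the boundary of the face \<open>u\<close> is the signed sum of the fundamental cycles of
  the cotree edges on it, and \<open>v\<close> is enclosed by this sum exactly if \<open>v = u\<close>. Seen as a function of
  \<open>v\<close>, the difference of the two sides does not change across cotree edges, so it is constant, and
  it vanishes at the outer face.
\<close>

lemma fundamental_cycles_dual_to_faces:
  assumes T: "T \<in> spanning_trees V E ends"
    and u: "u \<in> faces V E \<gamma>" "u \<noteq> outer_face V E \<gamma>" and v: "v \<in> faces V E \<gamma>"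
  shows "(\<Sum>e\<in>E - T. \<Sum>x | x \<in> faces V E \<gamma> \<and> dual_ends V E \<gamma> e = {u, x}.
           (of_bool (encloses \<gamma> (insert e T) u) - of_bool (encloses \<gamma> (insert e T) x)) *
            of_bool (encloses \<gamma> (insert e T) v)) = (of_bool (u = v) :: real)"
proof -
  let ?I = "\<lambda>e x. of_bool (encloses \<gamma> (insert e T) x) :: real"
  define d where "d e = (\<Sum>x | x \<in> faces V E \<gamma> \<and> dual_ends V E \<gamma> e = {u, x}. ?I e u - ?I e x)" for e
  define k where "k x = (\<Sum>e\<in>E - T. d e * ?I e x) - of_bool (u = x)" for x
  have d_eq: "d e = of_bool (u = a) - of_bool (u = b)"
    if ab: "a \<in> faces V E \<gamma>" "b \<in> faces V E \<gamma>" "dual_ends V E \<gamma> e = {a, b}"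
      "encloses \<gamma> (insert e T) a" "\<not> encloses \<gamma> (insert e T) b" for e a b
  proof -
    have ne: "a \<noteq> b" using ab by blast
    consider "u = a" | "u = b" | "u \<noteq> a" "u \<noteq> b" by blast
    then show ?thesis
    proof cases
      case 1
      then have "{x \<in> faces V E \<gamma>. dual_ends V E \<gamma> e = {u, x}} = {b}" using ab ne by (auto simp: doubleton_eq_iff)
      then show ?thesis using ab ne 1 by (simp add: d_def)
    next
      case 2
      then have "{x \<in> faces V E \<gamma>. dual_ends V E \<gamma> e = {u, x}} = {a}" using ab ne by (auto simp: doubleton_eq_iff)
      then show ?thesis using ab ne 2 by (simp add: d_def)
    next
      case 3
      then have none: "{x \<in> faces V E \<gamma>. dual_ends V E \<gamma> e = {u, x}} = {}" using ab by (auto simp: doubleton_eq_iff)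
      show ?thesis unfolding d_def none using 3 by simp
    qed
  qed
  have "k x = k y" if e': "e' \<in> E - T" and xy: "x \<in> dual_ends V E \<gamma> e'" "y \<in> dual_ends V E \<gamma> e'" for e' x y
  proof -
    obtain a b where ab: "a \<in> faces V E \<gamma>" "b \<in> faces V E \<gamma>" "dual_ends V E \<gamma> e' = {a, b}"
      "encloses \<gamma> (insert e' T) a" "\<not> encloses \<gamma> (insert e' T) b"
      using cotree_edge_faces[OF T e'] .
    have other: "?I e a = ?I e b" if "e \<in> E - T" "e \<noteq> e'" for e
    proof -
      have "e' \<notin> cycle_of ends (insert e T)" using fundamental_cycle(2)[OF T that(1)] e' that by auto
      then show ?thesis
        using enclosed_across_non_cycle_edge[OF tree_insert_unicycle(1)[OF edge_ends_in_V T that(1)], of e' a b] e' ab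
        by simp
    qed
    have "k a - k b = (\<Sum>e\<in>E - T. d e * (?I e a - ?I e b)) - (of_bool (u = a) - of_bool (u = b))"
      by (simp add: k_def right_diff_distrib sum_subtractf)
    also have "(\<Sum>e\<in>E - T. d e * (?I e a - ?I e b)) = (\<Sum>e\<in>E - T. if e = e' then d e' else 0)"
      using other ab by (intro sum.cong) auto
    also have "\<dots> = d e'" using e' finite_E by simp
    finally have "k a = k b" using d_eq[OF ab] by simp
    then show ?thesis using xy ab(3) by auto
  qed
  then have "k v = k (outer_face V E \<gamma>)" by (rule constant_across_cotree[OF T _ v outer_face(1)])
  also have "\<dots> = 0"
  proof -
    have "?I e (outer_face V E \<gamma>) = 0" if "e \<in> E - T" for e
      using outer_face_not_enclosed[OF tree_insert_unicycle(1)[OF edge_ends_in_V T that]] by simp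
    then show ?thesis using u by (simp add: k_def)
  qed
  finally show ?thesis by (simp add: k_def d_def sum_distrib_right)
qed

text \<open>
  Divided by \<^const>\<open>lambda\<close> this is the probability that \<open>u\<close> and \<open>v\<close> are both enclosed; divided by
  \<^const>\<open>kappa\<close> it will turn out to be Green's function of the dual graph.
\<close>

definition enclosing_weight :: "('e \<Rightarrow> real) \<Rightarrow> complex set \<Rightarrow> complex set \<Rightarrow> real" where
  "enclosing_weight c u v =
     (\<Sum>U\<in>spanning_unicycles V E ends.
        weight c U * (of_bool (encloses \<gamma> U u) * of_bool (encloses \<gamma> U v)))"

lemma finite_subgraphs:
  "finite (spanning_trees V E ends)" "finite (spanning_unicycles V E ends)"
  using finite_E by (auto simp: spanning_trees_def spanning_unicycles_def)

text \<open>
  Across \<open>e\<close> only the unicycles with \<open>e\<close> on their cycle contribute to the difference of the two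
  values. Dropping \<open>e\<close> from such a unicycle leaves a spanning tree and divides the weight by \<open>c e\<close>; so
  with the dual conductance \<open>1 / c e\<close> the Laplacian is a sum of weights of spanning trees.
\<close>

lemma dual_laplacian_enclosing_weight:
  assumes c: "\<forall>e\<in>E. c e > 0" and tree: "T0 \<in> spanning_trees V E ends"
    and u: "u \<in> faces V E \<gamma>" "u \<noteq> outer_face V E \<gamma>" and v: "v \<in> faces V E \<gamma>"
  shows "laplacian (faces V E \<gamma>) E (dual_ends V E \<gamma>) (dual_conductance c) (\<lambda>x. enclosing_weight c x v) u =
    kappa V E ends c * of_bool (u = v)"
proof -
  let ?trees = "spanning_trees V E ends"
  define g where "g x U = (of_bool (encloses \<gamma> U u) - of_bool (encloses \<gamma> U x)) * (of_bool (encloses \<gamma> U v) :: real)" for x U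
  have fin: "finite (faces V E \<gamma>)" using finite_faces tree .
  have edge: "dual_conductance c e * (enclosing_weight c u v - enclosing_weight c x v) =
      (\<Sum>T | T \<in> ?trees \<and> e \<notin> T. weight c T * g x (insert e T))"
    if e: "e \<in> E" "dual_ends V E \<gamma> e = {u, x}" for e x
  proof -
    have "enclosing_weight c u v - enclosing_weight c x v = (\<Sum>U\<in>spanning_unicycles V E ends. weight c U * g x U)"
      by (simp add: enclosing_weight_def g_def sum_subtractf[symmetric] algebra_simps)
    also have "\<dots> = (\<Sum>U | U \<in> spanning_unicycles V E ends \<and> e \<in> cycle_of ends U. weight c U * g x U)"
    proof (rule sum.mono_neutral_right[OF finite_subgraphs(2)])
      show "\<forall>U\<in>spanning_unicycles V E ends - {U \<in> spanning_unicycles V E ends. e \<in> cycle_of ends U}.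
              weight c U * g x U = 0"
        using enclosed_across_non_cycle_edge[OF _ e(1), of _ u x] e(2) by (auto simp: g_def)
    qed auto
    also have "\<dots> = c e * (\<Sum>T | T \<in> ?trees \<and> e \<notin> T. weight c T * g x (insert e T))"
      by (rule sum_unicycles_through_edge[OF edge_ends_in_V finite_E e(1)])
    finally show ?thesis using bspec[OF c e(1)] by (simp add: dual_conductance_def)
  qed
  have "laplacian (faces V E \<gamma>) E (dual_ends V E \<gamma>) (dual_conductance c) (\<lambda>x. enclosing_weight c x v) u =
    (\<Sum>x\<in>faces V E \<gamma>. \<Sum>e | e \<in> E \<and> dual_ends V E \<gamma> e = {u, x}. \<Sum>T | T \<in> ?trees \<and> e \<notin> T. weight c T * g x (insert e T))"
    unfolding laplacian_def using edge by (intro sum.cong refl) auto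
  also have "\<dots> = (\<Sum>e\<in>E. \<Sum>x | x \<in> faces V E \<gamma> \<and> dual_ends V E \<gamma> e = {u, x}. \<Sum>T | T \<in> ?trees \<and> e \<notin> T. weight c T * g x (insert e T))"
    by (rule sum.swap_restrict[OF fin finite_E])
  also have "\<dots> = (\<Sum>e\<in>E. \<Sum>T | T \<in> ?trees \<and> e \<notin> T. \<Sum>x | x \<in> faces V E \<gamma> \<and> dual_ends V E \<gamma> e = {u, x}. weight c T * g x (insert e T))"
    by (intro sum.cong refl sum.swap)
  also have "\<dots> = (\<Sum>T\<in>?trees. \<Sum>e | e \<in> E \<and> e \<notin> T. \<Sum>x | x \<in> faces V E \<gamma> \<and> dual_ends V E \<gamma> e = {u, x}. weight c T * g x (insert e T))"
    by (rule sum.swap_restrict[OF finite_E finite_subgraphs(1)])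
  also have "\<dots> = (\<Sum>T\<in>?trees. weight c T * of_bool (u = v))"
  proof (rule sum.cong[OF refl])
    fix T assume T: "T \<in> ?trees"
    have "{e \<in> E. e \<notin> T} = E - T" by blast
    then show "(\<Sum>e | e \<in> E \<and> e \<notin> T. \<Sum>x | x \<in> faces V E \<gamma> \<and> dual_ends V E \<gamma> e = {u, x}. weight c T * g x (insert e T)) =
      weight c T * of_bool (u = v)"
      using fundamental_cycles_dual_to_faces[OF T u v] by (simp add: g_def sum_distrib_left[symmetric])
  qed
  finally show ?thesis by (simp add: kappa_def sum_distrib_right)
qed

end

section \<open>Green's function\<close>

lemma laplacian_matrix_apply:
  assumes "finite V" "u \<in> V"
  shows "(\<Sum>w\<in>V. laplacian_matrix V E ends c u w * h w) = laplacian V E ends c h u"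
proof -
  have "(\<Sum>w\<in>V. laplacian_matrix V E ends c u w * h w) =
    (\<Sum>w\<in>V. \<Sum>v\<in>V. \<Sum>e | e \<in> E \<and> ends e = {u, v}. c e * ((if u = w then 1 else 0) - (if v = w then 1 else 0)) * h w)"
    by (simp add: laplacian_matrix_def laplacian_def sum_distrib_right)
  also have "\<dots> = (\<Sum>v\<in>V. \<Sum>e | e \<in> E \<and> ends e = {u, v}. \<Sum>w\<in>V. c e * ((if u = w then 1 else 0) - (if v = w then 1 else 0)) * h w)"
    by (subst sum.swap, intro sum.cong refl, rule sum.swap)
  also have "\<dots> = (\<Sum>v\<in>V. \<Sum>e | e \<in> E \<and> ends e = {u, v}. c e * (h u - h v))"
  proof (intro sum.cong refl)
    fix v e assume v: "v \<in> V"
    have "(\<Sum>w\<in>V. c e * ((if u = w then 1 else 0) - (if v = w then 1 else 0)) * h w) =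
      c e * ((\<Sum>w\<in>V. if u = w then h w else 0) - (\<Sum>w\<in>V. if v = w then h w else 0))"
      by (auto simp: sum_distrib_left sum_subtractf[symmetric] intro!: sum.cong)
    then show "(\<Sum>w\<in>V. c e * ((if u = w then 1 else 0) - (if v = w then 1 else 0)) * h w) = c e * (h u - h v)"
      using assms v by simp
  qed
  finally show ?thesis by (simp add: laplacian_def)
qed

lemma laplacian_matrix_off_diagonal:
  assumes "finite V" "u \<in> V" "w \<in> V" "u \<noteq> w"
  shows "laplacian_matrix V E ends c u w = - (\<Sum>e | e \<in> E \<and> ends e = {u, w}. c e)"
proof -
  have "laplacian_matrix V E ends c u w =
    (\<Sum>v\<in>V. if v = w then - (\<Sum>e | e \<in> E \<and> ends e = {u, w}. c e) else 0)"
    unfolding laplacian_matrix_def laplacian_def using assms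
    by (intro sum.cong) (auto simp: sum_negf)
  then show ?thesis using assms by simp
qed

lemma laplacian_matrix_commute:
  assumes "finite V" "u \<in> V" "w \<in> V"
  shows "laplacian_matrix V E ends c u w = laplacian_matrix V E ends c w u"
proof (cases "u = w")
  case False
  have "{u, w} = {w, u}" by blast
  then show ?thesis
    using False laplacian_matrix_off_diagonal[OF assms False, of E ends c]
      laplacian_matrix_off_diagonal[OF assms(1,3,2), of E ends c] by simp
qed simp

lemma matrix_inverse_on_eqI:
  assumes S: "finite S"
    and out: "\<And>u v. u \<notin> S \<or> v \<notin> S \<Longrightarrow> N u v = 0"
    and right: "\<And>u v. u \<in> S \<Longrightarrow> v \<in> S \<Longrightarrow> (\<Sum>w\<in>S. M u w * N w v) = (if u = v then 1 else 0)"
    and left: "\<And>u v. u \<in> S \<Longrightarrow> v \<in> S \<Longrightarrow> (\<Sum>w\<in>S. N u w * M w v) = (if u = v then 1 else 0)"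
  shows "matrix_inverse_on S M = N"
  unfolding matrix_inverse_on_def
proof (rule the_equality)
  fix N'
  assume N': "(\<forall>u v. u \<notin> S \<or> v \<notin> S \<longrightarrow> N' u v = 0) \<and>
    (\<forall>u\<in>S. \<forall>v\<in>S. (\<Sum>w\<in>S. M u w * N' w v) = (if u = v then 1 else 0) \<and>
                  (\<Sum>w\<in>S. N' u w * M w v) = (if u = v then 1 else 0))"
  show "N' = N"
  proof (intro ext)
    fix u v
    show "N' u v = N u v"
    proof (cases "u \<in> S \<and> v \<in> S")
      case True
      have "N' u v = (\<Sum>w\<in>S. (if u = w then 1 else 0) * N' w v)"
        using True S by (simp add: if_distrib[of "\<lambda>x. x * _"] cong: if_cong)
      also have "\<dots> = (\<Sum>w\<in>S. \<Sum>x\<in>S. N u x * M x w * N' w v)"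
        using True left by (simp add: sum_distrib_right[symmetric])
      also have "\<dots> = (\<Sum>x\<in>S. N u x * (\<Sum>w\<in>S. M x w * N' w v))"
        by (subst sum.swap) (simp add: sum_distrib_left mult.assoc)
      also have "\<dots> = (\<Sum>x\<in>S. N u x * (if x = v then 1 else 0))"
        using True N' by simp
      also have "\<dots> = N u v"
        using True S by (simp add: if_distrib[of "\<lambda>x. _ * x"] cong: if_cong)
      finally show ?thesis .
    next
      case False
      then show ?thesis using out N' by auto
    qed
  qed
qed (use out right left in auto)

text \<open>
  Because the Laplacian is symmetric, a symmetric right inverse is two-sided, so it is enough to
  solve the Dirichlet problem with a point source.
\<close>

lemma green_eqI:
  assumes V: "finite V" "b \<in> V"
    and out: "\<And>u v. u \<notin> V - {b} \<or> v \<notin> V - {b} \<Longrightarrow> N u v = 0"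
    and sym: "\<And>u v. N u v = N v u"
    and lap: "\<And>u v. u \<in> V - {b} \<Longrightarrow> v \<in> V - {b} \<Longrightarrow>
       laplacian V E ends c (\<lambda>x. N x v) u = (if u = v then 1 else 0)"
  shows "green V E ends c b = N"
  unfolding green_def
proof (rule matrix_inverse_on_eqI)
  let ?L = "laplacian_matrix V E ends c"
  show right: "(\<Sum>w\<in>V - {b}. ?L u w * N w v) = (if u = v then 1 else 0)"
    if uv: "u \<in> V - {b}" "v \<in> V - {b}" for u v
  proof -
    have "(\<Sum>w\<in>V. ?L u w * N w v) = ?L u b * N b v + (\<Sum>w\<in>V - {b}. ?L u w * N w v)"
      using V by (simp add: sum.remove)
    then show ?thesis using laplacian_matrix_apply[of V u E ends c "\<lambda>x. N x v"] V uv lap[OF uv] out[of b v] by simp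
  qed
  fix u v assume uv: "u \<in> V - {b}" "v \<in> V - {b}"
  have "(\<Sum>w\<in>V - {b}. N u w * ?L w v) = (\<Sum>w\<in>V - {b}. ?L v w * N w u)"
    using uv V laplacian_matrix_commute[of V v _ E ends c] sym by (intro sum.cong) (auto simp: mult.commute)
  then show "(\<Sum>w\<in>V - {b}. N u w * ?L w v) = (if u = v then 1 else 0)" using right[OF uv(2,1)] by auto
qed (use V out in auto)

context plane_multigraph
begin

lemma weight_pos: "\<forall>e\<in>E. c e > 0 \<Longrightarrow> F \<subseteq> E \<Longrightarrow> weight c F > 0"
  unfolding weight_def by (rule prod_pos) blast

lemma kappa_pos:
  assumes "\<forall>e\<in>E. c e > 0" "T \<in> spanning_trees V E ends"
  shows "kappa V E ends c > 0"
  unfolding kappa_def using finite_subgraphs assms weight_pos[OF assms(1)]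
  by (intro sum_pos) (auto simp: spanning_trees_def)

theorem dual_green_eq_enclosing_weight:
  assumes c: "\<forall>e\<in>E. c e > 0" and tree: "T \<in> spanning_trees V E ends"
    and uv: "u \<in> faces V E \<gamma>" "v \<in> faces V E \<gamma>"
  shows "dual_green V E \<gamma> c u v = enclosing_weight c u v / kappa V E ends c"
proof -
  let ?S = "faces V E \<gamma> - {outer_face V E \<gamma>}"
  have outer0: "enclosing_weight c x y = 0" if "x = outer_face V E \<gamma> \<or> y = outer_face V E \<gamma>" for x y
    using outer_face_not_enclosed that by (auto simp: enclosing_weight_def intro!: sum.neutral)
  define N where "N x y = (if x \<in> ?S \<and> y \<in> ?S then enclosing_weight c x y / kappa V E ends c else 0)" for x y
  have N_eq: "N x y = enclosing_weight c x y / kappa V E ends c"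
    if "x \<in> faces V E \<gamma>" "y \<in> faces V E \<gamma>" for x y
    using that outer0 by (auto simp: N_def)
  have "dual_green V E \<gamma> c = N"
    unfolding dual_green_def
  proof (rule green_eqI)
    show "finite (faces V E \<gamma>)" using finite_faces tree .
    show "outer_face V E \<gamma> \<in> faces V E \<gamma>" by (rule outer_face)
    show "N x y = N y x" for x y by (auto simp: N_def enclosing_weight_def mult.commute)
    show "N x y = 0" if "x \<notin> ?S \<or> y \<notin> ?S" for x y using that by (auto simp: N_def)
    fix x y assume x: "x \<in> ?S" and y: "y \<in> ?S"
    have "laplacian (faces V E \<gamma>) E (dual_ends V E \<gamma>) (dual_conductance c) (\<lambda>z. N z y) x =
      laplacian (faces V E \<gamma>) E (dual_ends V E \<gamma>) (dual_conductance c) (\<lambda>z. enclosing_weight c z y) x / kappa V E ends c"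
      unfolding laplacian_def sum_divide_distrib
    proof (intro sum.cong refl)
      fix z e assume "z \<in> faces V E \<gamma>"
      then show "dual_conductance c e * (N x y - N z y) =
        dual_conductance c e * (enclosing_weight c x y - enclosing_weight c z y) / kappa V E ends c"
        using x y N_eq[of x y] N_eq[of z y] by (simp add: diff_divide_distrib right_diff_distrib)
    qed
    then show "laplacian (faces V E \<gamma>) E (dual_ends V E \<gamma>) (dual_conductance c) (\<lambda>z. N z y) x = (if x = y then 1 else 0)"
      using dual_laplacian_enclosing_weight[OF c tree, of x y] x y kappa_pos[OF c tree] by auto
  qed
  then show ?thesis using N_eq[OF uv] by simp
qed

end

section \<open>Hitting times of a continuous-time chain\<close>

text \<open>
  The chain is observed until it hits \<open>b\<close>. The function \<open>g\<close> solves \<open>- Q g = 1\<close> with \<open>g = 0\<close> at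
  \<open>b\<close>; a nonnegative solution certifies that \<open>b\<close> is reached, and \<open>g x\<close> turns out to be the expected
  hitting time from \<open>x\<close>.
\<close>

locale chain_with_target =
  fixes S :: "'s set" and b :: 's and Q :: "'s \<Rightarrow> 's \<Rightarrow> real" and g :: "'s \<Rightarrow> real"
  assumes finite_S: "finite S" and b_in: "b \<in> S"
    and Q_nonneg: "\<And>x y. x \<in> S \<Longrightarrow> y \<in> S \<Longrightarrow> x \<noteq> y \<Longrightarrow> Q x y \<ge> 0"
    and Q_row: "\<And>x. x \<in> S \<Longrightarrow> (\<Sum>y\<in>S. Q x y) = 0"
    and g_nonneg: "\<And>x. x \<in> S - {b} \<Longrightarrow> g x \<ge> 0"
    and g_eq: "\<And>x. x \<in> S - {b} \<Longrightarrow> - (\<Sum>y\<in>S - {b}. Q x y * g y) = 1"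
begin

abbreviation S' :: "'s set" where "S' \<equiv> S - {b}"

abbreviation p :: "'s \<Rightarrow> 's \<Rightarrow> real" where "p \<equiv> jump_prob Q"

abbreviation q :: "'s \<Rightarrow> real" where "q x \<equiv> - Q x x"

definition step :: "('s \<Rightarrow> real) \<Rightarrow> 's \<Rightarrow> real" where
  "step f x = (\<Sum>y\<in>S'. p x y * f y)"

lemma q_mult_g: "x \<in> S' \<Longrightarrow> q x * g x = 1 + (\<Sum>y\<in>S' - {x}. Q x y * g y)"
  using g_eq[of x] finite_S by (simp add: sum.remove[of S' x])

lemma q_pos_g_pos: assumes x: "x \<in> S'" shows "q x > 0 \<and> g x > 0"
proof -
  have "(\<Sum>y\<in>S' - {x}. Q x y * g y) \<ge> 0"
    using x Q_nonneg g_nonneg by (intro sum_nonneg mult_nonneg_nonneg) auto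
  then have "q x * g x > 0" using q_mult_g[OF x] by linarith
  then show ?thesis using g_nonneg[OF x] unfolding zero_less_mult_iff by linarith
qed

lemma q_pos: "x \<in> S' \<Longrightarrow> q x > 0" and g_pos: "x \<in> S' \<Longrightarrow> g x > 0"
  using q_pos_g_pos by auto

lemma p_nonneg: "x \<in> S' \<Longrightarrow> y \<in> S \<Longrightarrow> p x y \<ge> 0"
  using divide_nonneg_pos[OF Q_nonneg[of x y] q_pos[of x]] by (auto simp: jump_prob_def)

lemma p_row: assumes x: "x \<in> S'" shows "(\<Sum>y\<in>S. p x y) = 1"
proof -
  have "(\<Sum>y\<in>S. p x y) = (\<Sum>y\<in>S - {x}. p x y)"
    using x finite_S by (simp add: sum.remove[of S x] jump_prob_def)
  also have "\<dots> = (\<Sum>y\<in>S - {x}. Q x y) / q x"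
    unfolding sum_divide_distrib by (intro sum.cong) (auto simp: jump_prob_def)
  also have "(\<Sum>y\<in>S - {x}. Q x y) = q x"
    using Q_row[of x] x finite_S by (simp add: sum.remove)
  finally show ?thesis using q_pos[OF x] by simp
qed

lemma step_g: assumes x: "x \<in> S'" shows "g x = 1 / q x + step g x"
proof -
  have "step g x = (\<Sum>y\<in>S' - {x}. p x y * g y)"
    using x finite_S by (simp add: step_def sum.remove[of S' x] jump_prob_def)
  also have "\<dots> = (\<Sum>y\<in>S' - {x}. Q x y * g y) / q x"
    unfolding sum_divide_distrib by (intro sum.cong) (auto simp: jump_prob_def)
  finally have "q x * step g x = q x * g x - 1" using q_mult_g[OF x] q_pos[OF x] by simp
  then show ?thesis using q_pos[OF x] by (simp add: field_simps)
qed

lemma step_mono: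
  assumes "\<And>y. y \<in> S' \<Longrightarrow> f y \<le> h y" "x \<in> S'"
  shows "step f x \<le> step h x"
  unfolding step_def using assms p_nonneg by (intro sum_mono mult_left_mono) auto

lemma step_pow_mono:
  assumes "\<And>y. y \<in> S' \<Longrightarrow> f y \<le> h y" "x \<in> S'"
  shows "(step ^^ n) f x \<le> (step ^^ n) h x"
  using assms(2) by (induction n arbitrary: x) (auto intro: step_mono assms(1))

lemma step_pow_zero: "(step ^^ n) (\<lambda>_. 0) x = 0"
proof (induction n arbitrary: x)
  case (Suc n)
  then have "(step ^^ n) (\<lambda>_. 0) = (\<lambda>_. 0)" by blast
  then have "(step ^^ Suc n) (\<lambda>_. 0) x = step (\<lambda>_. 0) x" by simp
  also have "\<dots> = 0" by (simp add: step_def)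
  finally show ?case .
qed simp

lemma step_pow_nonneg:
  assumes "\<And>y. y \<in> S' \<Longrightarrow> f y \<ge> 0" "x \<in> S'"
  shows "(step ^^ n) f x \<ge> 0"
  using step_pow_mono[of "\<lambda>_. 0" f x n] assms by (simp add: step_pow_zero)

lemma step_scale: "step (\<lambda>y. a * f y) x = a * step f x"
  by (simp add: step_def sum_distrib_left mult.left_commute)

lemma step_pow_scale: "(step ^^ n) (\<lambda>y. a * f y) x = a * (step ^^ n) f x"
proof (induction n arbitrary: x)
  case (Suc n)
  then have "(step ^^ n) (\<lambda>y. a * f y) = (\<lambda>y. a * (step ^^ n) f y)" by blast
  then show ?case by (simp add: step_scale)
qed simp

text \<open>
  Since \<open>g = 1 / q + step g\<close> with \<open>1 / q\<close> at least a fixed fraction of \<open>g\<close>, the operator \<open>step\<close>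
  contracts \<open>g\<close>, and with it every bounded function.
\<close>

lemma step_pow_g_tendsto_0:
  assumes x: "x \<in> S'"
  shows "(\<lambda>n. (step ^^ n) g x) \<longlonglongrightarrow> 0"
proof -
  \<comment> \<open>the smallest ratio between \<open>1 / q\<close> and \<open>g\<close>\<close>
  define d where "d = Min ((\<lambda>y. 1 / (q y * g y)) ` S')"
  have fin: "finite ((\<lambda>y. 1 / (q y * g y)) ` S')" and ne: "(\<lambda>y. 1 / (q y * g y)) ` S' \<noteq> {}"
    using finite_S x by auto
  have d_le: "d \<le> 1 / (q y * g y)" if "y \<in> S'" for y
    unfolding d_def by (rule Min_le[OF fin]) (use that in blast)
  have d_pos: "d > 0"
    unfolding d_def using fin ne
  proof (subst Min_gr_iff)
    show "\<forall>a\<in>(\<lambda>y. 1 / (q y * g y)) ` S'. 0 < a"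
    proof
      fix a assume "a \<in> (\<lambda>y. 1 / (q y * g y)) ` S'"
      then obtain y where "y \<in> S'" "a = 1 / (q y * g y)" by blast
      then show "0 < a" using mult_pos_pos[OF q_pos g_pos] by (simp only: zero_less_divide_1_iff)
    qed
  qed auto
  have contract: "step g y \<le> (1 - d) * g y" if y: "y \<in> S'" for y
  proof -
    have "d * g y \<le> 1 / (q y * g y) * g y"
      using d_le[OF y] g_nonneg[OF y] by (intro mult_right_mono) auto
    also have "\<dots> = 1 / q y" using g_pos[OF y] by simp
    finally have "d * g y \<le> 1 / q y" .
    then show ?thesis using step_g[OF y] by (simp add: left_diff_distrib)
  qed
  have d_le_1: "d \<le> 1"
  proof (rule ccontr)
    assume "\<not> d \<le> 1"
    then have "(1 - d) * g x < 0" using g_pos[OF x] by (simp add: mult_neg_pos)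
    moreover have "step g x \<ge> 0" using step_pow_nonneg[of g x 1] g_nonneg x by simp
    ultimately show False using contract[OF x] by linarith
  qed
  have pow: "(step ^^ n) g y \<le> (1 - d) ^ n * g y" if y: "y \<in> S'" for n y
    using y
  proof (induction n arbitrary: y)
    case (Suc n)
    have "(step ^^ Suc n) g y \<le> step (\<lambda>z. (1 - d) ^ n * g z) y"
      using Suc by (auto intro: step_mono)
    also have "\<dots> = (1 - d) ^ n * step g y" by (rule step_scale)
    also have "\<dots> \<le> (1 - d) ^ n * ((1 - d) * g y)"
      using contract Suc.prems d_le_1 by (intro mult_left_mono) auto
    finally show ?case by (simp add: algebra_simps)
  qed simp
  have "(\<lambda>n. (1 - d) ^ n) \<longlonglongrightarrow> 0" using d_pos d_le_1 by (intro LIMSEQ_power_zero) auto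
  then have lim: "(\<lambda>n. (1 - d) ^ n * g x) \<longlonglongrightarrow> 0" by (rule tendsto_mult_left_zero)
  show ?thesis
    by (rule tendsto_sandwich[OF _ _ tendsto_const lim])
       (use pow[OF x] step_pow_nonneg[of g x] g_nonneg x in auto)
qed

lemma step_pow_one_tendsto_0:
  assumes x: "x \<in> S'"
  shows "(\<lambda>n. (step ^^ n) (\<lambda>_. 1) x) \<longlonglongrightarrow> 0"
proof -
  define a where "a = (\<Sum>y\<in>S'. 1 / g y)"
  have "1 \<le> a * g y" if y: "y \<in> S'" for y
  proof -
    have "1 / g y \<le> a"
      unfolding a_def using y finite_S g_pos by (intro member_le_sum) (auto intro: less_imp_le)
    then show ?thesis using g_pos[OF y] by (simp add: field_simps)
  qed
  then have le: "(step ^^ n) (\<lambda>_. 1) x \<le> a * (step ^^ n) g x" for n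
    using step_pow_mono[of "\<lambda>_. 1" "\<lambda>y. a * g y" x n] x by (simp add: step_pow_scale)
  have lim: "(\<lambda>n. a * (step ^^ n) g x) \<longlonglongrightarrow> 0"
    using step_pow_g_tendsto_0[OF x] by (rule tendsto_mult_right_zero)
  show ?thesis
    by (rule tendsto_sandwich[OF _ _ tendsto_const lim])
       (use le step_pow_nonneg[of "\<lambda>_. 1" x] x in auto)
qed

lemma step_pow_sums_g:
  assumes x: "x \<in> S'"
  shows "(\<lambda>n. (step ^^ n) (\<lambda>y. 1 / q y) x) sums g x"
proof -
  have rec: "(step ^^ n) g x = (step ^^ n) (\<lambda>y. 1 / q y) x + (step ^^ Suc n) g x" if "x \<in> S'" for n x
    using that
  proof (induction n arbitrary: x)
    case 0
    then show ?case using step_g by simp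
  next
    case (Suc n)
    have "step ((step ^^ n) g) x = (\<Sum>y\<in>S'. p x y * ((step ^^ n) (\<lambda>y. 1 / q y) y + (step ^^ Suc n) g y))"
      unfolding step_def[of _ x] using Suc.IH by (intro sum.cong) auto
    also have "\<dots> = step ((step ^^ n) (\<lambda>y. 1 / q y)) x + step ((step ^^ Suc n) g) x"
      by (simp only: step_def[of _ x] distrib_left sum.distrib)
    finally show ?case by simp
  qed
  have "(\<Sum>k<n. (step ^^ k) (\<lambda>y. 1 / q y) x) = g x - (step ^^ n) g x" for n
  proof (induction n)
    case (Suc n)
    then show ?case using rec[OF x, of n] by simp
  qed simp
  then show ?thesis
    unfolding sums_def using tendsto_diff[OF tendsto_const step_pow_g_tendsto_0[OF x], of "g x"] by simp
qed

definition path_sum :: "nat \<Rightarrow> (nat \<Rightarrow> 's set) \<Rightarrow> ('s \<Rightarrow> real) \<Rightarrow> real" where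
  "path_sum n Z f = (\<Sum>y\<in>PiE {..n} Z. (\<Prod>i<n. p (y i) (y (Suc i))) * f (y n))"

lemma path_sum_0: "path_sum 0 Z f = (\<Sum>x\<in>Z 0. f x)"
  unfolding path_sum_def
  by (rule sum.reindex_bij_witness[where i = "\<lambda>x. restrict (\<lambda>_. x) {..0}" and j = "\<lambda>y. y 0"])
     (auto simp: PiE_iff extensional_def fun_eq_iff)

lemma path_sum_Suc:
  "path_sum (Suc n) Z f = path_sum n Z (\<lambda>x. \<Sum>z\<in>Z (Suc n). p x z * f z)"
proof -
  have *: "(\<Prod>i<Suc n. p ((y(Suc n := z)) i) ((y(Suc n := z)) (Suc i))) = (\<Prod>i<n. p (y i) (y (Suc i))) * p (y n) z" for y z
    by simp
  have "path_sum (Suc n) Z f = (\<Sum>(z, y)\<in>Z (Suc n) \<times> PiE {..n} Z. (\<Prod>i<n. p (y i) (y (Suc i))) * p (y n) z * f z)"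
    unfolding path_sum_def atMost_Suc PiE_insert_eq
    using inj_combinator[of "Suc n" "{..n}" Z]
    by (subst sum.reindex) (auto simp: * case_prod_beta intro!: sum.cong)
  also have "\<dots> = (\<Sum>y\<in>PiE {..n} Z. \<Sum>z\<in>Z (Suc n). (\<Prod>i<n. p (y i) (y (Suc i))) * p (y n) z * f z)"
    by (subst sum.cartesian_product[symmetric]) (rule sum.swap)
  finally show ?thesis by (simp add: path_sum_def sum_distrib_left mult.assoc)
qed

lemma path_sum_cong:
  assumes "\<And>i. i \<le> n \<Longrightarrow> Z i = Z' i" "\<And>x. x \<in> Z n \<Longrightarrow> f x = f' x"
  shows "path_sum n Z f = path_sum n Z' f'"
proof -
  have "PiE {..n} Z = PiE {..n} Z'" using assms(1) by (intro PiE_cong) auto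
  then show ?thesis unfolding path_sum_def using assms by (intro sum.cong) (auto simp: PiE_iff)
qed

lemma path_sum_avoiding: "path_sum n (\<lambda>_. S') f = (\<Sum>x\<in>S'. (step ^^ n) f x)"
proof (induction n arbitrary: f)
  case (Suc n)
  have "path_sum (Suc n) (\<lambda>_. S') f = path_sum n (\<lambda>_. S') (step f)"
    unfolding path_sum_Suc by (simp add: step_def[abs_def])
  then show ?case using Suc by (simp add: funpow_swap1)
qed (simp add: path_sum_0)

text \<open>
  The hitting time is the sum of the holding times \<open>T i\<close> over all \<open>i\<close> such that the chain has avoided
  \<open>b\<close> up to its \<open>i\<close>-th jump. Given such a path ending in \<open>x\<close>, the holding time \<open>T i\<close> has mean \<open>1 / q x\<close>,
  so the \<open>i\<close>-th term of the sum has expectation \<open>step ^^ i\<close> applied to \<open>1 / q\<close>, averaged over the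
  starting point, and these terms add up to the average of \<open>g\<close>.
\<close>

theorem expected_hitting_time_eq:
  fixes M :: "'w measure"
  assumes chain: "uniform_markov_chain M S Q X"
  shows "expected_hitting_time M X b = ennreal ((\<Sum>x\<in>S'. g x) / real (card S))"
proof -
  from chain obtain Y :: "nat \<Rightarrow> 'w \<Rightarrow> 's" and T :: "nat \<Rightarrow> 'w \<Rightarrow> real" where M: "prob_space M"
    and Y: "\<And>n. Y n \<in> measurable M (count_space S)" and T [measurable]: "\<And>n. T n \<in> borel_measurable M"
    and law: "\<And>n y t. \<forall>i\<le>n. y i \<in> S \<and> 0 \<le> t i \<Longrightarrow>
           measure M {\<omega> \<in> space M. \<forall>i\<le>n. Y i \<omega> = y i \<and> t i < T i \<omega>} =
             1 / real (card S) * (\<Prod>i<n. p (y i) (y (Suc i))) * (\<Prod>i\<le>n. exp (Q (y i) (y i) * t i))"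
    and X: "AE \<omega> in M. \<forall>n t. 0 \<le> t \<and> jump_time T n \<omega> \<le> t \<and> t < jump_time T (Suc n) \<omega> \<longrightarrow> X t \<omega> = Y n \<omega>"
    unfolding uniform_markov_chain_def by blast
  interpret prob_space M by (rule M)
  have card_S: "real (card S) > 0" using finite_S b_in by (auto simp: card_gt_0_iff)
  have Y_in [measurable]: "Measurable.pred M (\<lambda>\<omega>. Y i \<omega> \<in> Z)" for i Z
    by (rule measurable_compose[OF Y measurable_count_space])
  \<comment> \<open>positive holding times keep the intervals between successive jumps nonempty, so that every
    state of the jump chain is a value of \<open>X\<close>; the bound \<open>t\<close> on the last one gives its law\<close>
  define ev where "ev n Z t = {\<omega> \<in> space M. \<forall>i\<le>n. Y i \<omega> \<in> Z i \<and> (if i = n then t else 0) < T i \<omega>}"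
    for n :: nat and Z :: "nat \<Rightarrow> 's set" and t :: real
  have ev_sets [measurable]: "ev n Z t \<in> sets M" for n Z t
    unfolding ev_def by measurable
  have ev_prob: "prob (ev n Z t) = path_sum n Z (\<lambda>x. exp (Q x x * t)) / card S"
    if Z: "\<And>i. i \<le> n \<Longrightarrow> Z i \<subseteq> S" and t: "0 \<le> t" for n Z t
  proof -
    let ?e = "\<lambda>y. {\<omega> \<in> space M. \<forall>i\<le>n. Y i \<omega> = y i \<and> (if i = n then t else 0) < T i \<omega>}"
    have e_ev: "?e y = ev n (\<lambda>i. {y i}) t" for y by (simp add: ev_def)
    have e_val: "Y j \<omega> = y j" if "\<omega> \<in> ?e y" "j \<le> n" for \<omega> y j using that by simp
    have fin: "finite (PiE {..n} Z)" using Z finite_S by (intro finite_PiE) (auto intro: finite_subset)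
    have "ev n Z t = (\<Union>y\<in>PiE {..n} Z. ?e y)"
    proof
      show "ev n Z t \<subseteq> (\<Union>y\<in>PiE {..n} Z. ?e y)"
      proof
        fix \<omega> assume "\<omega> \<in> ev n Z t"
        then have "restrict (\<lambda>i. Y i \<omega>) {..n} \<in> PiE {..n} Z" "\<omega> \<in> ?e (restrict (\<lambda>i. Y i \<omega>) {..n})"
          by (auto simp: ev_def)
        then show "\<omega> \<in> (\<Union>y\<in>PiE {..n} Z. ?e y)" by blast
      qed
    qed (auto simp: ev_def PiE_iff)
    also have "prob \<dots> = (\<Sum>y\<in>PiE {..n} Z. prob (?e y))"
    proof (rule finite_measure_finite_Union[OF fin])
      show "?e ` PiE {..n} Z \<subseteq> events" using e_ev ev_sets by (intro image_subsetI) simp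
      show "disjoint_family_on ?e (PiE {..n} Z)"
        unfolding disjoint_family_on_def
      proof (intro ballI impI)
        fix y y' assume "y \<in> PiE {..n} Z" "y' \<in> PiE {..n} Z" "y \<noteq> y'"
        then obtain i where i: "i \<le> n" "y i \<noteq> y' i" by (metis PiE_ext atMost_iff)
        show "?e y \<inter> ?e y' = {}"
        proof (rule equals0I)
          fix \<omega> assume "\<omega> \<in> ?e y \<inter> ?e y'"
          then have "\<omega> \<in> ?e y" "\<omega> \<in> ?e y'" by (simp_all only: Int_iff)
          from this[THEN e_val, OF i(1)] show False using i(2) by simp
        qed
      qed
    qed
    also have "\<dots> = (\<Sum>y\<in>PiE {..n} Z. (\<Prod>i<n. p (y i) (y (Suc i))) * exp (Q (y n) (y n) * t) / card S)"
    proof (rule sum.cong[OF refl])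
      fix y assume y: "y \<in> PiE {..n} Z"
      have "(\<Prod>i\<le>n. exp (Q (y i) (y i) * (if i = n then t else 0))) = (\<Prod>i\<le>n. if i = n then exp (Q (y n) (y n) * t) else 1)"
        by (intro prod.cong) auto
      also have "\<dots> = exp (Q (y n) (y n) * t)" by simp
      finally show "prob (?e y) = (\<Prod>i<n. p (y i) (y (Suc i))) * exp (Q (y n) (y n) * t) / card S"
        using law[of n y "\<lambda>i. if i = n then t else 0"] y Z t by (fastforce simp: PiE_iff)
    qed
    finally show ?thesis by (simp add: path_sum_def sum_divide_distrib)
  qed
  define avoid where "avoid n t = ev n (\<lambda>_. S') t" for n t
  define hits where "hits n = ev n (\<lambda>i. if i = n then {b} else S') 0" for n
  have [measurable]: "avoid n t \<in> sets M" "hits n \<in> sets M" for n t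
    unfolding avoid_def hits_def by measurable
  have avoid_iff: "\<omega> \<in> avoid n t \<longleftrightarrow>
      \<omega> \<in> space M \<and> (\<forall>j\<le>n. Y j \<omega> \<in> S') \<and> (\<forall>j<n. 0 < T j \<omega>) \<and> t < T n \<omega>" for n t \<omega>
    unfolding avoid_def ev_def mem_Collect_eq le_less by (metis less_irrefl)
  have avoid_prob: "prob (avoid n t) = (\<Sum>x\<in>S'. (step ^^ n) (\<lambda>x. exp (Q x x * t)) x) / card S" if "0 \<le> t" for n t
    unfolding avoid_def using ev_prob[of n "\<lambda>_. S'" t] that by (simp add: path_sum_avoiding)
  have avoid_0: "prob (avoid n 0) = (\<Sum>x\<in>S'. (step ^^ n) (\<lambda>_. 1) x) / card S" for n
    using avoid_prob[of 0 n] by simp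
  have hits_0: "prob (hits 0) = 1 / card S"
    unfolding hits_def using b_in by (subst ev_prob) (auto simp: path_sum_0)
  have hits_Suc: "prob (hits (Suc n)) = prob (avoid n 0) - prob (avoid (Suc n) 0)" for n
  proof -
    have "prob (hits (Suc n)) = path_sum (Suc n) (\<lambda>i. if i = Suc n then {b} else S') (\<lambda>_. 1) / card S"
      unfolding hits_def using b_in by (subst ev_prob) auto
    also have "path_sum (Suc n) (\<lambda>i. if i = Suc n then {b} else S') (\<lambda>_. 1) = path_sum n (\<lambda>_. S') (\<lambda>x. p x b)"
      unfolding path_sum_Suc by (rule path_sum_cong) auto
    also have "\<dots> = path_sum n (\<lambda>_. S') (\<lambda>x. 1 - step (\<lambda>_. 1) x)"
    proof (rule path_sum_cong)
      fix x assume "x \<in> S'"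
      then show "p x b = 1 - step (\<lambda>_. 1) x"
        using p_row[of x] b_in finite_S by (simp add: step_def sum.remove)
    qed simp
    also have "\<dots> = path_sum n (\<lambda>_. S') (\<lambda>_. 1) - path_sum n (\<lambda>_. S') (step (\<lambda>_. 1))"
      by (simp add: path_sum_def right_diff_distrib sum_subtractf)
    finally show ?thesis
      by (simp add: avoid_0 path_sum_avoiding funpow_swap1 diff_divide_distrib)
  qed
  have hits_sum: "(\<Sum>k\<le>n. prob (hits k)) = 1 - prob (avoid n 0)" for n
  proof (induction n)
    case 0
    have "card S = Suc (card S')" using finite_S b_in by (metis card.remove)
    then show ?case using card_S by (simp add: hits_0 avoid_0 field_simps)
  next
    case (Suc n)
    then show ?case by (simp add: hits_Suc)
  qed
  have "(\<lambda>n. prob (avoid n 0)) \<longlonglongrightarrow> (\<Sum>x\<in>S'. 0) / card S"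
    unfolding avoid_0 using step_pow_one_tendsto_0 card_S by (intro tendsto_intros) auto
  then have avoid_lim: "(\<lambda>n. prob (avoid n 0)) \<longlonglongrightarrow> 0" by simp
  have disj: "disjoint_family hits"
    unfolding disjoint_family_on_def
  proof (intro ballI impI)
    fix m n :: nat assume "m \<noteq> n"
    have "hits m \<inter> hits n = {}" if "m < n" for m n
      using that by (force simp: hits_def ev_def)
    then show "hits m \<inter> hits n = {}" using \<open>m \<noteq> n\<close> by (metis Int_commute linorder_neqE_nat)
  qed
  \<comment> \<open>the probabilities of \<open>hits\<close> telescope, so \<open>b\<close> is reached almost surely\<close>
  have hits_AE: "AE \<omega> in M. \<exists>n. \<omega> \<in> hits n"
  proof -
    have "(\<lambda>k. prob (hits k)) sums prob (\<Union>n. hits n)"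
      using disj by (intro finite_measure_UNION) auto
    then have "(\<lambda>n. 1 - prob (avoid n 0)) \<longlonglongrightarrow> prob (\<Union>n. hits n)"
      unfolding sums_def_le hits_sum .
    moreover have "(\<lambda>n. 1 - prob (avoid n 0)) \<longlonglongrightarrow> 1 - 0" using avoid_lim by (intro tendsto_intros)
    ultimately have "prob (\<Union>n. hits n) = 1" using LIMSEQ_unique by fastforce
    then have "AE \<omega> in M. \<omega> \<in> (\<Union>n. hits n)" by (subst prob_eq_1[symmetric]) auto
    then show ?thesis by simp
  qed
  have "AE \<omega> in M. hitting_time X b \<omega> = (\<Sum>i. ennreal (T i \<omega>) * indicator (avoid i 0) \<omega>)"
    using X hits_AE
  proof eventually_elim
    fix \<omega> assume X: "\<forall>n t. 0 \<le> t \<and> jump_time T n \<omega> \<le> t \<and> t < jump_time T (Suc n) \<omega> \<longrightarrow> X t \<omega> = Y n \<omega>"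
      and "\<exists>n. \<omega> \<in> hits n"
    then obtain n where n: "\<omega> \<in> hits n" by blast
    have \<omega>: "\<omega> \<in> space M" using n by (simp add: hits_def ev_def)
    have position: "Y i \<omega> \<in> (if i = n then {b} else S') \<and> 0 < T i \<omega>" if "i \<le> n" for i
      using n that by (simp add: hits_def ev_def)
    have Yn: "Y n \<omega> = b" using position[of n] by simp
    have Yi: "Y i \<omega> \<in> S'" if "i < n" for i using position[of i] that by simp
    have Ti: "T i \<omega> > 0" if "i \<le> n" for i using position[OF that] by simp
    have J_nonneg: "jump_time T m \<omega> \<ge> 0" if "m \<le> n" for m
      unfolding jump_time_def using that Ti by (intro sum_nonneg) (auto intro: less_imp_le)
    have "hitting_time X b \<omega> = ennreal (jump_time T n \<omega>)"
      unfolding hitting_time_def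
    proof (rule antisym)
      have "X (jump_time T n \<omega>) \<omega> = b"
        using X[rule_format, of "jump_time T n \<omega>" n] J_nonneg[of n] Ti[of n] Yn by (simp add: jump_time_def)
      then show "Inf (ennreal ` {t. 0 \<le> t \<and> X t \<omega> = b}) \<le> ennreal (jump_time T n \<omega>)"
        using J_nonneg[of n] by (intro Inf_lower) auto
      show "ennreal (jump_time T n \<omega>) \<le> Inf (ennreal ` {t. 0 \<le> t \<and> X t \<omega> = b})"
      proof (rule Inf_greatest)
        fix r assume "r \<in> ennreal ` {t. 0 \<le> t \<and> X t \<omega> = b}"
        then obtain t where t: "r = ennreal t" "0 \<le> t" "X t \<omega> = b" by blast
        have "X t \<omega> \<in> S'" if "t < jump_time T m \<omega>" "m \<le> n" for m
          using that
        proof (induction m)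
          case 0
          then show ?case using t by (simp add: jump_time_def)
        next
          case (Suc m)
          show ?case
          proof (cases "t < jump_time T m \<omega>")
            case False
            then have "X t \<omega> = Y m \<omega>" using X Suc.prems t by auto
            then show ?thesis using Yi[of m] Suc.prems by simp
          qed (use Suc in simp)
        qed
        from this[of n] have "jump_time T n \<omega> \<le> t" using t by force
        then show "ennreal (jump_time T n \<omega>) \<le> r" using t by (simp add: ennreal_leI)
      qed
    qed
    also have "\<dots> = (\<Sum>i<n. ennreal (T i \<omega>))"
      unfolding jump_time_def using Ti by (subst sum_ennreal) (auto intro: less_imp_le)
    also have "\<dots> = (\<Sum>i<n. ennreal (T i \<omega>) * indicator (avoid i 0) \<omega>)"
    proof (intro sum.cong refl)
      fix i assume "i \<in> {..<n}"
      then have "\<omega> \<in> avoid i 0" using \<omega> Yi Ti by (auto simp: avoid_def ev_def)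
      then show "ennreal (T i \<omega>) = ennreal (T i \<omega>) * indicator (avoid i 0) \<omega>" by simp
    qed
    also have "\<dots> = (\<Sum>i. ennreal (T i \<omega>) * indicator (avoid i 0) \<omega>)"
    proof (rule suminf_finite[symmetric])
      fix i assume "i \<notin> {..<n}"
      have "\<omega> \<notin> avoid i 0"
      proof
        assume "\<omega> \<in> avoid i 0"
        then have "Y n \<omega> \<in> S'" using \<open>i \<notin> {..<n}\<close> by (simp add: avoid_def ev_def)
        then show False using Yn by simp
      qed
      then show "ennreal (T i \<omega>) * indicator (avoid i 0) \<omega> = 0" by simp
    qed simp
    finally show "hitting_time X b \<omega> = (\<Sum>i. ennreal (T i \<omega>) * indicator (avoid i 0) \<omega>)" .
  qed
  then have "expected_hitting_time M X b = (\<integral>\<^sup>+\<omega>. (\<Sum>i. ennreal (T i \<omega>) * indicator (avoid i 0) \<omega>) \<partial>M)"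
    unfolding expected_hitting_time_def by (rule nn_integral_cong_AE)
  also have "\<dots> = (\<Sum>i. \<integral>\<^sup>+\<omega>. ennreal (T i \<omega>) * indicator (avoid i 0) \<omega> \<partial>M)"
    by (rule nn_integral_suminf) measurable
  \<comment> \<open>the mean of a holding time as the integral of its tail probabilities\<close>
  also have "\<dots> = (\<Sum>i. ennreal ((\<Sum>x\<in>S'. (step ^^ i) (\<lambda>x. 1 / q x) x) / card S))"
  proof (rule suminf_cong)
    fix i
    let ?w = "\<lambda>y. (\<Prod>j<i. p (y j) (y (Suc j))) / card S"
    have fin: "finite (PiE {..i} (\<lambda>_. S'))" using finite_S by (intro finite_PiE) auto
    have w_nonneg: "?w y \<ge> 0" if "y \<in> PiE {..i} (\<lambda>_. S')" for y
      using that p_nonneg by (intro divide_nonneg_nonneg prod_nonneg) (auto simp: PiE_iff)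
    have [measurable]: "Measurable.pred (M \<Otimes>\<^sub>M lborel) (\<lambda>(\<omega>, t). \<omega> \<in> avoid i 0 \<and> t \<in> {0..<T i \<omega>})"
      unfolding atLeastLessThan_iff by measurable
    have "(\<integral>\<^sup>+\<omega>. ennreal (T i \<omega>) * indicator (avoid i 0) \<omega> \<partial>M) =
      (\<integral>\<^sup>+\<omega>. \<integral>\<^sup>+t. of_bool (\<omega> \<in> avoid i 0 \<and> t \<in> {0..<T i \<omega>}) \<partial>lborel \<partial>M)"
    proof (rule nn_integral_cong)
      fix \<omega> assume "\<omega> \<in> space M"
      have "T i \<omega> > 0" if "\<omega> \<in> avoid i 0" using that by (force simp: avoid_def ev_def)
      moreover have "(\<integral>\<^sup>+t. of_bool (0 \<le> t \<and> t < T i \<omega>) \<partial>lborel) = emeasure lborel {0..<T i \<omega>}"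
      proof -
        have "(\<integral>\<^sup>+t. of_bool (0 \<le> t \<and> t < T i \<omega>) \<partial>lborel) = (\<integral>\<^sup>+t. indicator {0..<T i \<omega>} t \<partial>lborel)"
          by (intro nn_integral_cong) (simp add: indicator_def)
        then show ?thesis by simp
      qed
      ultimately show "ennreal (T i \<omega>) * indicator (avoid i 0) \<omega> =
        (\<integral>\<^sup>+t. of_bool (\<omega> \<in> avoid i 0 \<and> t \<in> {0..<T i \<omega>}) \<partial>lborel)"
        by (cases "\<omega> \<in> avoid i 0") auto
    qed
    also have "\<dots> = (\<integral>\<^sup>+t. \<integral>\<^sup>+\<omega>. of_bool (\<omega> \<in> avoid i 0 \<and> t \<in> {0..<T i \<omega>}) \<partial>M \<partial>lborel)"
    proof -
      interpret pair_sigma_finite lborel M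
        by (intro pair_sigma_finite.intro sigma_finite_lborel sigma_finite_measure_axioms)
      show ?thesis
        by (rule Fubini') (measurable, simp add: case_prod_beta)
    qed
    also have "\<dots> = (\<integral>\<^sup>+t. (\<Sum>y\<in>PiE {..i} (\<lambda>_. S'). ennreal (?w y) * (ennreal (exp (Q (y i) (y i) * t)) * indicator {0..} t)) \<partial>lborel)"
    proof (rule nn_integral_cong)
      fix t :: real
      show "(\<integral>\<^sup>+\<omega>. of_bool (\<omega> \<in> avoid i 0 \<and> t \<in> {0..<T i \<omega>}) \<partial>M) =
        (\<Sum>y\<in>PiE {..i} (\<lambda>_. S'). ennreal (?w y) * (ennreal (exp (Q (y i) (y i) * t)) * indicator {0..} t))"
      proof (cases "0 \<le> t")
        case True
        have "(\<integral>\<^sup>+\<omega>. of_bool (\<omega> \<in> avoid i 0 \<and> t \<in> {0..<T i \<omega>}) \<partial>M) = (\<integral>\<^sup>+\<omega>. indicator (avoid i t) \<omega> \<partial>M)"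
        proof (rule nn_integral_cong)
          fix \<omega> assume "\<omega> \<in> space M"
          have "\<omega> \<in> avoid i 0 \<and> t < T i \<omega> \<longleftrightarrow> \<omega> \<in> avoid i t"
            unfolding avoid_iff using True by (metis le_less_trans)
          then show "of_bool (\<omega> \<in> avoid i 0 \<and> t \<in> {0..<T i \<omega>}) = (indicator (avoid i t) \<omega> :: ennreal)"
            using True by (auto simp: indicator_def)
        qed
        also have "\<dots> = ennreal (prob (avoid i t))" by (simp add: emeasure_eq_measure)
        also have "prob (avoid i t) = (\<Sum>y\<in>PiE {..i} (\<lambda>_. S'). ?w y * exp (Q (y i) (y i) * t))"
          unfolding avoid_def using True by (subst ev_prob) (auto simp: path_sum_def sum_divide_distrib)
        also have "ennreal \<dots> = (\<Sum>y\<in>PiE {..i} (\<lambda>_. S'). ennreal (?w y * exp (Q (y i) (y i) * t)))"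
          by (rule sum_ennreal[symmetric]) (rule mult_nonneg_nonneg[OF w_nonneg], simp_all)
        also have "\<dots> = (\<Sum>y\<in>PiE {..i} (\<lambda>_. S'). ennreal (?w y) * (ennreal (exp (Q (y i) (y i) * t)) * indicator {0..} t))"
        proof (rule sum.cong[OF refl])
          fix y assume "y \<in> PiE {..i} (\<lambda>_. S')"
          from ennreal_mult[OF w_nonneg[OF this] exp_ge_zero]
          show "ennreal (?w y * exp (Q (y i) (y i) * t)) = ennreal (?w y) * (ennreal (exp (Q (y i) (y i) * t)) * indicator {0..} t)"
            using True by (simp only: indicator_simps(1) atLeast_iff mult_1_right)
        qed
        finally show ?thesis .
      qed simp
    qed
    also have "\<dots> = (\<Sum>y\<in>PiE {..i} (\<lambda>_. S'). \<integral>\<^sup>+t. ennreal (?w y) * (ennreal (exp (Q (y i) (y i) * t)) * indicator {0..} t) \<partial>lborel)"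
      by (rule nn_integral_sum) measurable
    also have "\<dots> = (\<Sum>y\<in>PiE {..i} (\<lambda>_. S'). ennreal (?w y * (1 / q (y i))))"
    proof (rule sum.cong[OF refl])
      fix y assume y: "y \<in> PiE {..i} (\<lambda>_. S')"
      then have qy: "q (y i) > 0" using q_pos[of "y i"] by (auto simp: PiE_iff)
      have "(\<integral>\<^sup>+t. ennreal (exp (Q (y i) (y i) * t)) * indicator {0..} t \<partial>lborel) = ennreal (0 - (- exp (Q (y i) (y i) * 0) / q (y i)))"
      proof (rule nn_integral_FTC_atLeast)
        show "((\<lambda>t. - exp (Q (y i) (y i) * t) / q (y i)) has_real_derivative exp (Q (y i) (y i) * t)) (at t)" for t
          using qy by (auto intro!: derivative_eq_intros simp: field_simps)
        have "filterlim (\<lambda>t. Q (y i) (y i) * t) at_bot at_top"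
          using qy by (intro filterlim_tendsto_neg_mult_at_bot[OF tendsto_const _ filterlim_ident]) auto
        then have "((\<lambda>t. exp (Q (y i) (y i) * t)) \<longlongrightarrow> 0) at_top"
          by (rule filterlim_compose[OF exp_at_bot])
        then have "((\<lambda>t. - exp (Q (y i) (y i) * t) / q (y i)) \<longlongrightarrow> - 0 / q (y i)) at_top"
          using qy by (intro tendsto_intros) auto
        then show "((\<lambda>t. - exp (Q (y i) (y i) * t) / q (y i)) \<longlongrightarrow> 0) at_top" by simp
      qed auto
      then show "(\<integral>\<^sup>+t. ennreal (?w y) * (ennreal (exp (Q (y i) (y i) * t)) * indicator {0..} t) \<partial>lborel) = ennreal (?w y * (1 / q (y i)))"
        using w_nonneg[OF y] qy by (subst nn_integral_cmult) (auto simp: ennreal_mult[symmetric])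
    qed
    also have "\<dots> = ennreal (\<Sum>y\<in>PiE {..i} (\<lambda>_. S'). ?w y * (1 / q (y i)))"
    proof (rule sum_ennreal)
      fix y assume y: "y \<in> PiE {..i} (\<lambda>_. S')"
      then have "q (y i) > 0" using q_pos[of "y i"] by (auto simp: PiE_iff)
      then show "?w y * (1 / q (y i)) \<ge> 0" using w_nonneg[OF y] by (intro mult_nonneg_nonneg) auto
    qed
    also have "(\<Sum>y\<in>PiE {..i} (\<lambda>_. S'). ?w y * (1 / q (y i))) = path_sum i (\<lambda>_. S') (\<lambda>x. 1 / q x) / card S"
      by (simp add: path_sum_def sum_divide_distrib mult.commute)
    finally show "(\<integral>\<^sup>+\<omega>. ennreal (T i \<omega>) * indicator (avoid i 0) \<omega> \<partial>M) =
      ennreal ((\<Sum>x\<in>S'. (step ^^ i) (\<lambda>x. 1 / q x) x) / card S)"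
      by (simp only: path_sum_avoiding)
  qed
  also have "\<dots> = ennreal ((\<Sum>x\<in>S'. g x) / card S)"
  proof (rule suminf_ennreal_eq)
    show "(\<lambda>i. (\<Sum>x\<in>S'. (step ^^ i) (\<lambda>x. 1 / q x) x) / card S) sums ((\<Sum>x\<in>S'. g x) / card S)"
      using step_pow_sums_g by (intro sums_divide sums_sum) auto
    show "0 \<le> (\<Sum>x\<in>S'. (step ^^ i) (\<lambda>x. 1 / q x) x) / card S" for i
    proof (rule divide_nonneg_nonneg[OF sum_nonneg])
      fix x assume "x \<in> S'"
      then show "(step ^^ i) (\<lambda>x. 1 / q x) x \<ge> 0"
        by (rule step_pow_nonneg[rotated]) (use q_pos in \<open>auto intro: less_imp_le\<close>)
    qed simp
  qed
  finally show ?thesis .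
qed

end

section \<open>Expectations over the random unicycle\<close>

context plane_multigraph
begin

lemma unicycle_exists:
  assumes T: "T \<in> spanning_trees V E ends" and "\<exists>C\<subseteq>E. is_cycle ends C"
  shows "spanning_unicycles V E ends \<noteq> {}"
proof -
  have "\<not> E \<subseteq> T" using assms by (auto simp: spanning_trees_def)
  then obtain e where e: "e \<in> E - T" by blast
  have "insert e T \<in> spanning_unicycles V E ends"
    by (rule tree_insert_unicycle(1)[OF _ T e]) (rule edge_ends_in_V)
  then show ?thesis by blast
qed

lemma lambda_pos:
  assumes "\<forall>e\<in>E. c e > 0" "spanning_unicycles V E ends \<noteq> {}"
  shows "lambda V E ends c > 0"
  unfolding lambda_def
proof (rule sum_pos[OF finite_subgraphs(2) assms(2)])
  fix U assume "U \<in> spanning_unicycles V E ends"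
  then show "weight c U > 0" using weight_pos[of c U] assms(1) by (auto simp: spanning_unicycles_def)
qed

lemma pmf_random_unicycle:
  assumes c: "\<forall>e\<in>E. c e > 0" and ne: "spanning_unicycles V E ends \<noteq> {}"
  shows "pmf (random_unicycle V E ends c) U =
    (if U \<in> spanning_unicycles V E ends then weight c U / lambda V E ends c else 0)"
  unfolding random_unicycle_def
proof (rule pmf_embed_pmf)
  let ?f = "\<lambda>U. if U \<in> spanning_unicycles V E ends then weight c U / lambda V E ends c else 0"
  have w: "weight c U \<ge> 0" if "U \<in> spanning_unicycles V E ends" for U
    using weight_pos[of c U] c that by (auto simp: spanning_unicycles_def intro: less_imp_le)
  show nonneg: "0 \<le> ?f U" for U
    using w[of U] lambda_pos[OF c ne] by simp
  have "(\<integral>\<^sup>+U. ennreal (?f U) \<partial>count_space UNIV) = (\<Sum>U\<in>spanning_unicycles V E ends. ennreal (?f U))"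
    by (rule nn_integral_count_space'[OF finite_subgraphs(2)]) auto
  also have "\<dots> = ennreal (\<Sum>U\<in>spanning_unicycles V E ends. ?f U)"
    by (rule sum_ennreal) (rule nonneg)
  also have "(\<Sum>U\<in>spanning_unicycles V E ends. ?f U) = 1"
    using lambda_pos[OF c ne] by (simp add: sum_divide_distrib[symmetric] lambda_def[symmetric])
  finally show "(\<integral>\<^sup>+U. ennreal (?f U) \<partial>count_space UNIV) = 1" by simp
qed

lemma expectation_random_unicycle:
  assumes c: "\<forall>e\<in>E. c e > 0" and ne: "spanning_unicycles V E ends \<noteq> {}"
  shows "measure_pmf.expectation (random_unicycle V E ends c) h =
    (\<Sum>U\<in>spanning_unicycles V E ends. weight c U * h U) / lambda V E ends c"
proof -
  note pmf = pmf_random_unicycle[OF c ne]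
  have "measure_pmf.expectation (random_unicycle V E ends c) h =
    (\<Sum>U\<in>spanning_unicycles V E ends. h U * pmf (random_unicycle V E ends c) U)"
    by (rule integral_measure_pmf_real[OF finite_subgraphs(2)]) (auto simp: set_pmf_iff pmf split: if_splits)
  also have "\<dots> = (\<Sum>U\<in>spanning_unicycles V E ends. weight c U * h U) / lambda V E ends c"
    unfolding sum_divide_distrib by (intro sum.cong) (auto simp: pmf)
  finally show ?thesis .
qed

lemma prob_random_unicycle:
  assumes c: "\<forall>e\<in>E. c e > 0" and ne: "spanning_unicycles V E ends \<noteq> {}"
  shows "measure_pmf.prob (random_unicycle V E ends c) {U. P U} =
    (\<Sum>U\<in>spanning_unicycles V E ends. weight c U * of_bool (P U)) / lambda V E ends c"
proof -
  have "measure_pmf.prob (random_unicycle V E ends c) {U. P U} =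
    measure_pmf.expectation (random_unicycle V E ends c) (indicator {U. P U})" by simp
  then show ?thesis
    by (simp only: expectation_random_unicycle[OF c ne] indicator_def mem_Collect_eq)
qed

lemma cycle_area_eq:
  assumes "finite (faces V E \<gamma>)"
  shows "real (cycle_area V E \<gamma> U) = (\<Sum>f\<in>faces V E \<gamma>. of_bool (encloses \<gamma> U f))"
  using assms by (simp add: cycle_area_def Collect_conj_eq)

lemma expectation_cycle_area:
  assumes c: "\<forall>e\<in>E. c e > 0" and ne: "spanning_unicycles V E ends \<noteq> {}"
    and fin: "finite (faces V E \<gamma>)"
  shows "measure_pmf.expectation (random_unicycle V E ends c) (\<lambda>U. real (cycle_area V E \<gamma> U)) =
      (\<Sum>f\<in>faces V E \<gamma>. enclosing_weight c f f) / lambda V E ends c"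
    and "measure_pmf.expectation (random_unicycle V E ends c) (\<lambda>U. (real (cycle_area V E \<gamma> U))\<^sup>2) =
      (\<Sum>f\<in>faces V E \<gamma>. \<Sum>f'\<in>faces V E \<gamma>. enclosing_weight c f f') / lambda V E ends c"
proof -
  let ?I = "\<lambda>U f. of_bool (encloses \<gamma> U f) :: real"
  let ?F = "faces V E \<gamma>"
  have "(\<Sum>U\<in>spanning_unicycles V E ends. weight c U * real (cycle_area V E \<gamma> U)) =
    (\<Sum>U\<in>spanning_unicycles V E ends. \<Sum>f\<in>?F. weight c U * (?I U f * ?I U f))"
    unfolding cycle_area_eq[OF fin] sum_distrib_left by (intro sum.cong refl) simp
  also have "\<dots> = (\<Sum>f\<in>?F. enclosing_weight c f f)"
    unfolding enclosing_weight_def by (rule sum.swap)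
  finally show "measure_pmf.expectation (random_unicycle V E ends c) (\<lambda>U. real (cycle_area V E \<gamma> U)) =
      (\<Sum>f\<in>?F. enclosing_weight c f f) / lambda V E ends c"
    by (simp add: expectation_random_unicycle[OF c ne])
  have "(\<Sum>U\<in>spanning_unicycles V E ends. weight c U * (real (cycle_area V E \<gamma> U))\<^sup>2) =
    (\<Sum>U\<in>spanning_unicycles V E ends. \<Sum>f\<in>?F. \<Sum>f'\<in>?F. weight c U * (?I U f * ?I U f'))"
    unfolding cycle_area_eq[OF fin] power2_eq_square sum_product by (simp only: sum_distrib_left)
  also have "\<dots> = (\<Sum>f\<in>?F. \<Sum>U\<in>spanning_unicycles V E ends. \<Sum>f'\<in>?F. weight c U * (?I U f * ?I U f'))"
    by (rule sum.swap)
  also have "\<dots> = (\<Sum>f\<in>?F. \<Sum>f'\<in>?F. enclosing_weight c f f')"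
    unfolding enclosing_weight_def by (intro sum.cong refl sum.swap)
  finally show "measure_pmf.expectation (random_unicycle V E ends c) (\<lambda>U. (real (cycle_area V E \<gamma> U))\<^sup>2) =
      (\<Sum>f\<in>?F. \<Sum>f'\<in>?F. enclosing_weight c f f') / lambda V E ends c"
    by (simp add: expectation_random_unicycle[OF c ne])
qed

text \<open>
  The row sums of Green's function solve the equation that characterises the expected hitting time;
  they are nonnegative because the entries are sums of weights of unicycles.
\<close>

lemma expected_dual_hitting_time:
  assumes c: "\<forall>e\<in>E. c e > 0" and tree: "T \<in> spanning_trees V E ends"
    and chain: "uniform_markov_chain M (faces V E \<gamma>) (\<lambda>u v. - dual_laplacian_matrix V E \<gamma> c u v) X"
  shows "expected_hitting_time M X (outer_face V E \<gamma>) =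
    ennreal ((\<Sum>f\<in>faces V E \<gamma>. \<Sum>f'\<in>faces V E \<gamma>. enclosing_weight c f f') / kappa V E ends c / real (card (faces V E \<gamma>)))"
proof -
  let ?F = "faces V E \<gamma>" and ?b = "outer_face V E \<gamma>" and ?L = "dual_laplacian_matrix V E \<gamma> c"
  have fin: "finite ?F" using finite_faces[OF tree] .
  have kappa: "kappa V E ends c > 0" using kappa_pos[OF c tree] .
  define g where "g x = (\<Sum>z\<in>?F. enclosing_weight c x z) / kappa V E ends c" for x
  have weight_nonneg: "weight c U \<ge> 0" if "U \<in> spanning_unicycles V E ends" for U
    using weight_pos[of c U] c that by (auto simp: spanning_unicycles_def intro: less_imp_le)
  have L_apply: "(\<Sum>w\<in>?F. ?L u w * h w) = laplacian ?F E (dual_ends V E \<gamma>) (dual_conductance c) h u"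
    if "u \<in> ?F" for u h
    unfolding dual_laplacian_matrix_def by (rule laplacian_matrix_apply[OF fin that])
  have g_outer: "g ?b = 0"
    using outer_face_not_enclosed by (simp add: g_def enclosing_weight_def)
  interpret chain_with_target ?F ?b "\<lambda>u v. - ?L u v" g
  proof
    show "finite ?F" "?b \<in> ?F" using fin outer_face(1) .
    fix x assume x: "x \<in> ?F"
    show "(\<Sum>y\<in>?F. - ?L x y) = 0"
      using L_apply[OF x, of "\<lambda>_. 1"] by (simp add: laplacian_def sum_negf)
    fix y assume "y \<in> ?F" "x \<noteq> y"
    then have "?L x y = - (\<Sum>e | e \<in> E \<and> dual_ends V E \<gamma> e = {x, y}. dual_conductance c e)"
      unfolding dual_laplacian_matrix_def using laplacian_matrix_off_diagonal[OF fin x] by blast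
    moreover have "(\<Sum>e | e \<in> E \<and> dual_ends V E \<gamma> e = {x, y}. dual_conductance c e) \<ge> 0"
      using c by (intro sum_nonneg) (auto simp: dual_conductance_def intro: less_imp_le)
    ultimately show "- ?L x y \<ge> 0" by simp
  next
    fix x assume x: "x \<in> ?F - {?b}"
    show "g x \<ge> 0"
      unfolding g_def enclosing_weight_def using weight_nonneg kappa
      by (intro divide_nonneg_pos sum_nonneg mult_nonneg_nonneg) auto
    have "(\<Sum>y\<in>?F - {?b}. ?L x y * g y) = (\<Sum>y\<in>?F. ?L x y * g y)"
      using fin outer_face(1) g_outer by (simp add: sum.remove)
    also have "\<dots> = (\<Sum>z\<in>?F. (\<Sum>y\<in>?F. ?L x y * enclosing_weight c y z) / kappa V E ends c)"
      unfolding g_def by (simp add: sum_divide_distrib sum_distrib_left) (rule sum.swap)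
    also have "\<dots> = (\<Sum>z\<in>?F. if x = z then 1 else 0)"
    proof (rule sum.cong[OF refl])
      fix z assume z: "z \<in> ?F"
      have "(\<Sum>y\<in>?F. ?L x y * enclosing_weight c y z) = kappa V E ends c * of_bool (x = z)"
        using dual_laplacian_enclosing_weight[OF c tree, of x z] x z
          L_apply[of x "\<lambda>y. enclosing_weight c y z"] by simp
      then show "(\<Sum>y\<in>?F. ?L x y * enclosing_weight c y z) / kappa V E ends c = (if x = z then 1 else 0)"
        using kappa by simp
    qed
    also have "\<dots> = 1" using x fin by simp
    finally show "- (\<Sum>y\<in>?F - {?b}. - ?L x y * g y) = 1" by (simp add: sum_negf)
  qed
  have "expected_hitting_time M X ?b = ennreal ((\<Sum>x\<in>?F - {?b}. g x) / real (card ?F))"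
    by (rule expected_hitting_time_eq[OF chain])
  also have "(\<Sum>x\<in>?F - {?b}. g x) = (\<Sum>x\<in>?F. g x)"
    using fin outer_face(1) g_outer by (simp add: sum.remove)
  also have "\<dots> = (\<Sum>f\<in>?F. \<Sum>f'\<in>?F. enclosing_weight c f f') / kappa V E ends c"
    by (simp add: g_def sum_divide_distrib)
  finally show ?thesis .
qed

end

theorem theorem7:
  fixes V :: "complex set" and E :: "'e set" and \<gamma> :: "'e \<Rightarrow> real \<Rightarrow> complex"
    and c :: "'e \<Rightarrow> real" and f f' :: "complex set"
  assumes "plane_graph V E \<gamma>"
    and "spanning_connected V (curve_ends \<gamma>) E"
    and "\<exists>C\<subseteq>E. is_cycle (curve_ends \<gamma>) C"
    and "\<And>e. e \<in> E \<Longrightarrow> c e > 0"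
    and "f \<in> faces V E \<gamma>" and "f' \<in> faces V E \<gamma>"
  shows
    "(measure_pmf.prob (random_unicycle V E (curve_ends \<gamma>) c) {U. encloses \<gamma> U f} =
           kappa V E (curve_ends \<gamma>) c / lambda V E (curve_ends \<gamma>) c * dual_green V E \<gamma> c f f) \<and>
     (measure_pmf.prob (random_unicycle V E (curve_ends \<gamma>) c)
             {U. encloses \<gamma> U f \<and> encloses \<gamma> U f'} =
           kappa V E (curve_ends \<gamma>) c / lambda V E (curve_ends \<gamma>) c * dual_green V E \<gamma> c f f') \<and>
     (measure_pmf.expectation (random_unicycle V E (curve_ends \<gamma>) c)
             (\<lambda>U. real (cycle_area V E \<gamma> U)) =
           kappa V E (curve_ends \<gamma>) c / lambda V E (curve_ends \<gamma>) c *
             (\<Sum>v\<in>faces V E \<gamma>. dual_green V E \<gamma> c v v)) \<and>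
     (\<forall>(M :: 'w measure) X.
           uniform_markov_chain M (faces V E \<gamma>) (\<lambda>u v. - dual_laplacian_matrix V E \<gamma> c u v) X \<longrightarrow>
           ennreal (measure_pmf.expectation (random_unicycle V E (curve_ends \<gamma>) c)
             (\<lambda>U. (real (cycle_area V E \<gamma> U))\<^sup>2)) =
           ennreal (kappa V E (curve_ends \<gamma>) c / lambda V E (curve_ends \<gamma>) c) *
             of_nat (card (faces V E \<gamma>)) *
             expected_hitting_time M X (outer_face V E \<gamma>))"
proof -
  interpret plane_multigraph V E \<gamma> by unfold_locales (rule assms(1))
  have c: "\<forall>e\<in>E. c e > 0" using assms(4) by blast
  note f = assms(5) and f' = assms(6)
  let ?F = "faces V E \<gamma>" and ?kappa = "kappa V E ends c" and ?lambda = "lambda V E ends c"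
  obtain T where T: "T \<in> spanning_trees V E ends"
    using spanning_tree_exists[OF finite_E assms(2)] by blast
  have ne: "spanning_unicycles V E ends \<noteq> {}" using unicycle_exists[OF T assms(3)] .
  have fin: "finite ?F" using finite_faces[OF T] .
  have kappa: "?kappa > 0" using kappa_pos[OF c T] .
  have lambda: "?lambda > 0" using lambda_pos[OF c ne] .
  note prob = prob_random_unicycle[OF c ne]
  note green = dual_green_eq_enclosing_weight[OF c T]
  have scale: "?kappa / ?lambda * dual_green V E \<gamma> c u v = enclosing_weight c u v / ?lambda"
    if "u \<in> ?F" "v \<in> ?F" for u v
    using green[OF that] kappa by simp
  have 1: "measure_pmf.prob (random_unicycle V E ends c) {U. encloses \<gamma> U f} =
      ?kappa / ?lambda * dual_green V E \<gamma> c f f"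
    unfolding scale[OF f f] prob enclosing_weight_def of_bool_conj[symmetric] by simp
  have 2: "measure_pmf.prob (random_unicycle V E ends c) {U. encloses \<gamma> U f \<and> encloses \<gamma> U f'} =
      ?kappa / ?lambda * dual_green V E \<gamma> c f f'"
    unfolding scale[OF f f'] prob enclosing_weight_def of_bool_conj ..
  have 3: "measure_pmf.expectation (random_unicycle V E ends c) (\<lambda>U. real (cycle_area V E \<gamma> U)) =
      ?kappa / ?lambda * (\<Sum>v\<in>?F. dual_green V E \<gamma> c v v)"
    unfolding expectation_cycle_area(1)[OF c ne fin] sum_distrib_left sum_divide_distrib
    by (intro sum.cong refl) (simp only: scale)
  have 4: "ennreal (measure_pmf.expectation (random_unicycle V E ends c) (\<lambda>U. (real (cycle_area V E \<gamma> U))\<^sup>2)) =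
      ennreal (?kappa / ?lambda) * of_nat (card ?F) * expected_hitting_time M X (outer_face V E \<gamma>)"
    if chain: "uniform_markov_chain M ?F (\<lambda>u v. - dual_laplacian_matrix V E \<gamma> c u v) X"
    for M :: "'w measure" and X
  proof -
    let ?G = "\<Sum>f\<in>?F. \<Sum>f'\<in>?F. enclosing_weight c f f'"
    have card: "real (card ?F) > 0" using fin f by (auto simp: card_gt_0_iff)
    have "ennreal (?kappa / ?lambda) * of_nat (card ?F) * expected_hitting_time M X (outer_face V E \<gamma>) =
      ennreal (?kappa / ?lambda * real (card ?F)) * ennreal (?G / ?kappa / real (card ?F))"
      unfolding expected_dual_hitting_time[OF c T chain]
      using kappa lambda by (simp only: ennreal_mult[OF less_imp_le[OF divide_pos_pos] of_nat_0_le_iff] ennreal_of_nat_eq_real_of_nat)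
    also have "\<dots> = ennreal (?kappa / ?lambda * real (card ?F) * (?G / ?kappa / real (card ?F)))"
      using kappa lambda by (subst ennreal_mult') auto
    also have "?kappa / ?lambda * real (card ?F) * (?G / ?kappa / real (card ?F)) = ?G / ?lambda"
      using kappa card by simp
    finally show ?thesis
      unfolding expectation_cycle_area(2)[OF c ne fin] by simp
  qed
  show ?thesis using 1 2 3 4 by blast
qed

end
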